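(* Let $\varphi,\psi$ be holomorphic self-maps of the unit disk $\mathbb{D}$. Then the compactness of $C_\varphi-C_\psi: H^p(\mathbb{D})\to H^p(\mathbb{D})$ does not depend on $p$ for $0<p<\infty$; that is, for all $p,q\in(0,\infty)$, $C_\varphi-C_\psi$ is compact on $H^p(\mathbb{D})$ if and only if it is compact on $H^q(\mathbb{D})$.
   Context: $\mathbb{D}$ is the open unit disk of $\mathbb{C}$, $\mathbb{T}=\partial\mathbb{D}$, and $m$ is the normalized Lebesgue measure on $\mathbb{T}$. A holomorphic self-map of $\mathbb{D}$ is a holomorphic function $\varphi:\mathbb{D}\to\mathbb{D}$; the composition operator is $C_\varphi f=f\circ\varphi$ for $f$ holomorphic in $\mathbb{D}$. For $0<p<\infty$, the Hardy space $H^p(\mathbb{D})$ consists of all holomorphic $f$ in $\mathbb{D}$ with $\|f\|_{H^p}^p=\sup_{0<r<1}\int_{\mathbb{T}}|f(r\zeta)|^p\,dm(\zeta)<\infty$ (a quasi-Banach space). By the Littlewood subordination principle each $C_\varphi$ is bounded on $H^p(\mathbb{D})$ for every $p>0$. A linear operator between quasi-Banach spaces is compact if it maps the unit ball to a relatively compact set. *)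

theory Defs
  imports "HOL-Analysis.Analysis"
begin

abbreviation unit_disc :: "complex set" where
  "unit_disc \<equiv> ball 0 1"

definition holomorphic_self_map :: "(complex \<Rightarrow> complex) \<Rightarrow> bool" where
  "holomorphic_self_map \<phi> \<longleftrightarrow> \<phi> holomorphic_on unit_disc \<and> \<phi> ` unit_disc \<subseteq> unit_disc"

text \<open>Normalized Lebesgue measure on the unit circle, as the push-forward of the uniform
  distribution on the interval from 0 to \<open>2 * pi\<close> under \<open>t \<mapsto> exp (i t)\<close>.\<close>

definition circle_measure :: "complex measure" where
  "circle_measure =
     distr (uniform_measure lborel {0..<2 * pi}) (restrict_space borel (sphere 0 1)) cis"

text \<open>The \<open>p\<close>-th power of the Hardy quasi-norm, possibly infinite.\<close>

definition hardy_sup :: "real \<Rightarrow> (complex \<Rightarrow> complex) \<Rightarrow> ennreal" where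
  "hardy_sup p f =
     (SUP r \<in> {0<..<1::real}.
        \<integral>\<^sup>+ \<zeta>. ennreal (cmod (f (complex_of_real r * \<zeta>)) powr p) \<partial>circle_measure)"

text \<open>A holomorphic function on the disc is represented by its extension by 0 to the whole
  plane, so that equality in the Hardy space is equality of functions on the disc.\<close>

definition hardy_space :: "real \<Rightarrow> (complex \<Rightarrow> complex) set" where
  "hardy_space p =
     {f. f holomorphic_on unit_disc \<and> (\<forall>z. z \<notin> unit_disc \<longrightarrow> f z = 0) \<and> hardy_sup p f < \<infinity>}"

definition hardy_norm :: "real \<Rightarrow> (complex \<Rightarrow> complex) \<Rightarrow> real" where
  "hardy_norm p f = enn2real (hardy_sup p f) powr (1 / p)"

definition composition_operator ::
  "(complex \<Rightarrow> complex) \<Rightarrow> (complex \<Rightarrow> complex) \<Rightarrow> complex \<Rightarrow> complex" where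
  "composition_operator \<phi> f = (\<lambda>z. if z \<in> unit_disc then f (\<phi> z) else 0)"

text \<open>The topology of a quasi-normed space with carrier \<open>V\<close> and quasi-norm \<open>N\<close>. Balls of a
  quasi-norm need not be open, so the open sets are defined as those containing a ball about each
  of their points, rather than as being generated by the balls.\<close>

definition quasinorm_topology :: "'a::minus set \<Rightarrow> ('a \<Rightarrow> real) \<Rightarrow> 'a topology" where
  "quasinorm_topology V N =
     topology (\<lambda>U. U \<subseteq> V \<and> (\<forall>f\<in>U. \<exists>\<epsilon>>0. \<forall>g\<in>V. N (g - f) < \<epsilon> \<longrightarrow> g \<in> U))"

lemma openin_quasinorm_topology:
  "openin (quasinorm_topology V N) U \<longleftrightarrow>
     U \<subseteq> V \<and> (\<forall>f\<in>U. \<exists>\<epsilon>>0. \<forall>g\<in>V. N (g - f) < \<epsilon> \<longrightarrow> g \<in> U)"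
proof -
  let ?P = "\<lambda>U. U \<subseteq> V \<and> (\<forall>f\<in>U. \<exists>\<epsilon>>0. \<forall>g\<in>V. N (g - f) < \<epsilon> \<longrightarrow> g \<in> U)"
  have "?P (S \<inter> T)" if S: "?P S" and T: "?P T" for S T
  proof (intro conjI ballI)
    show "S \<inter> T \<subseteq> V" using S by blast
    fix f assume f: "f \<in> S \<inter> T"
    obtain a where a: "a > 0" "\<forall>g\<in>V. N (g - f) < a \<longrightarrow> g \<in> S" using S f by blast
    obtain b where b: "b > 0" "\<forall>g\<in>V. N (g - f) < b \<longrightarrow> g \<in> T" using T f by blast
    show "\<exists>\<epsilon>>0. \<forall>g\<in>V. N (g - f) < \<epsilon> \<longrightarrow> g \<in> S \<inter> T"
      using a b by (intro exI[of _ "min a b"]) auto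
  qed
  moreover have "?P (\<Union>K)" if "\<forall>S\<in>K. ?P S" for K
    using that by (meson Sup_le_iff UnionE UnionI)
  ultimately have "istopology ?P"
    unfolding istopology_def by blast
  then show ?thesis
    by (simp add: quasinorm_topology_def topology_inverse')
qed

lemma topspace_quasinorm_topology [simp]: "topspace (quasinorm_topology V N) = V"
proof
  show "topspace (quasinorm_topology V N) \<subseteq> V"
    using openin_topspace[of "quasinorm_topology V N"] unfolding openin_quasinorm_topology by blast
  have "openin (quasinorm_topology V N) V"
    unfolding openin_quasinorm_topology using zero_less_one by blast
  then show "V \<subseteq> topspace (quasinorm_topology V N)"
    by (rule openin_subset)
qed

definition relatively_compactin :: "'a topology \<Rightarrow> 'a set \<Rightarrow> bool" where
  "relatively_compactin X S \<longleftrightarrow> S \<subseteq> topspace X \<and> compactin X (X closure_of S)"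

definition compact_operator ::
  "'a::minus set \<Rightarrow> ('a \<Rightarrow> real) \<Rightarrow> 'b::minus set \<Rightarrow> ('b \<Rightarrow> real) \<Rightarrow> ('a \<Rightarrow> 'b) \<Rightarrow> bool" where
  "compact_operator V N W M T \<longleftrightarrow>
     T ` V \<subseteq> W \<and> relatively_compactin (quasinorm_topology W M) (T ` {f \<in> V. N f \<le> 1})"

abbreviation compact_on_hardy ::
  "real \<Rightarrow> ((complex \<Rightarrow> complex) \<Rightarrow> complex \<Rightarrow> complex) \<Rightarrow> bool" where
  "compact_on_hardy p T \<equiv>
     compact_operator (hardy_space p) (hardy_norm p) (hardy_space p) (hardy_norm p) T"

end

theory Submission
  imports Defs "HOL-Complex_Analysis.Complex_Analysis"
begin

text \<open>
  Write \<open>T f = f \<circ> \<phi> - f \<circ> \<psi>\<close>. By Montel's theorem, \<open>T\<close> is compact on \<open>H\<^sup>p\<close> if and only if \<open>T\<close> maps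
  bounded sequences of \<open>H\<^sup>p\<close> that tend to 0 locally uniformly to sequences that tend to 0 in \<open>H\<^sup>p\<close>
  (\<open>compact_imp_null_to_null\<close>, \<open>null_to_null_imp_compact\<close>). The point is to pass this property from
  \<open>p\<close> to an arbitrary \<open>q\<close> (\<open>null_to_null_transfer\<close>).

  Raising functions to the power \<open>q / p\<close> would do so for a single composition operator and zero-free
  functions. For a difference one has to recover \<open>f (\<phi> z) \<approx> f (\<psi> z)\<close> from an approximate equality of
  powers, which determines the values up to an ambiguity of the argument only, and functions in \<open>H\<^sup>q\<close>
  may have zeros. Both obstacles are removed by a factorization \<open>f = m * h powr (2 / q)\<close> of the dilates
  of \<open>f\<close>, in which \<open>\<bar>m\<bar> \<le> 1\<close> and \<open>h\<close> has values in the right half-plane and is bounded in \<open>H\<^sup>2\<close> (\<open>sector_factorization\<close>). The function \<open>h\<close> is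
  the Herglotz integral of \<open>1 + \<bar>f\<bar> powr (q / 2)\<close>, whose real part is a harmonic majorant because
  powers of \<open>\<bar>f\<bar>\<close> are subharmonic (\<open>norm_powr_le_herglotz\<close>); its \<open>H\<^sup>2\<close>-norm is under control because the
  conjugate function is bounded in square mean. As the argument of \<open>h\<close> is bounded, the imaginary
  powers of \<open>h\<close> are bounded functions. Therefore \<open>m * h powr (2 / p)\<close> and
  \<open>m * h powr (2 / p + \<i> * \<tau>)\<close> are bounded in \<open>H\<^sup>p\<close>, and if \<open>f\<close> is small on a compact set, so are they.

  These two test functions suffice: if both take nearly equal values at \<open>\<phi> z\<close> and \<open>\<psi> z\<close>, relative to the
  size of \<open>h\<close> at these points, then dividing one relation by the other shows that \<open>h powr (\<i> * \<tau>)\<close>, hence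
  for a small \<open>\<tau>\<close> also \<open>h\<close>, and hence \<open>m\<close>, takes nearly equal values there, and so does \<open>f\<close>. Quantitatively,
  the power \<open>q\<close> of \<open>\<bar>T f\<bar>\<close> is bounded by \<open>\<epsilon>\<close> times the squares of \<open>\<bar>h\<bar>\<close> at the two points plus a multiple of
  the power \<open>p\<close> of \<open>T\<close> applied to the test functions (\<open>two_test_functions\<close>), and this is integrated over circles.
\<close>

section \<open>The normalized circle measure\<close>

lemma space_circle_measure [simp]: "space circle_measure = sphere 0 1"
  by (simp add: circle_measure_def space_restrict_space)

lemma cis_measurable_circle [measurable]:
  "cis \<in> uniform_measure lborel {0..<2 * pi} \<rightarrow>\<^sub>M restrict_space borel (sphere 0 1)"
  unfolding measurable_cong_sets[OF sets_uniform_measure refl]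
  by (auto intro!: measurable_restrict_space2 borel_measurable_continuous_onI continuous_intros)

lemma finite_measure_circle_measure: "finite_measure circle_measure"
  unfolding circle_measure_def
  by (intro finite_measure.finite_measure_distr cis_measurable_circle finite_measureI)
     (simp add: emeasure_uniform_measure)

lemma borel_measurable_circle:
  "continuous_on (sphere 0 1) f \<Longrightarrow> f \<in> borel_measurable circle_measure"
  unfolding circle_measure_def measurable_distr_eq1
  by (rule borel_measurable_continuous_on_restrict)

lemma integrable_circle [intro]:
  fixes g :: "complex \<Rightarrow> 'b::{banach,second_countable_topology}"
  assumes "continuous_on (sphere 0 1) g"
  shows "integrable circle_measure g"
proof -
  have "compact (g ` sphere 0 1)"
    using assms by (intro compact_continuous_image) auto
  then obtain B where "\<And>z. z \<in> sphere 0 1 \<Longrightarrow> norm (g z) \<le> B"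
    by (meson bounded_iff compact_imp_bounded imageI)
  then show ?thesis
    by (intro finite_measure.integrable_const_bound[OF finite_measure_circle_measure, of _ B] borel_measurable_circle assms AE_I2) auto
qed

text \<open>Integrals against the push-forward measure become integrals over \<open>[0, 2\<pi>]\<close>, the form in which contour
integrals over circles are given; the end point \<open>2\<pi>\<close> makes up a null set.\<close>

lemma circle_integral_eq:
  fixes g :: "complex \<Rightarrow> 'b::euclidean_space"
  assumes g: "continuous_on (sphere 0 1) g"
  shows "((\<lambda>t. g (cis t)) has_integral (2 * pi) *\<^sub>R (\<integral>\<zeta>. g \<zeta> \<partial>circle_measure)) {0..2 * pi}"
proof -
  have cont: "continuous_on {0..2 * pi} (\<lambda>t. g (cis t))"
    by (rule continuous_on_compose2[OF g]) (auto intro!: continuous_intros)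
  have gm: "g \<in> borel_measurable (restrict_space borel (sphere 0 1))"
    by (rule borel_measurable_continuous_on_restrict[OF g])
  have gc: "(\<lambda>t. g (cis t)) \<in> borel_measurable lborel"
    using measurable_compose[OF cis_measurable_circle gm]
    unfolding measurable_cong_sets[OF sets_uniform_measure refl] .
  have 1: "(\<integral>\<zeta>. g \<zeta> \<partial>circle_measure) = (\<integral>t. g (cis t) \<partial>uniform_measure lborel {0..<2 * pi})"
    unfolding circle_measure_def by (rule integral_distr[OF cis_measurable_circle gm])
  have "uniform_measure lborel {0..<2 * pi} =
      density lborel (\<lambda>t::real. ennreal (indicator {0..<2*pi} t / (2 * pi)))"
    unfolding uniform_measure_def
    by (intro density_cong) (auto simp: indicator_def divide_ennreal simp flip: ennreal_1)
  then have 2: "(\<integral>\<zeta>. g \<zeta> \<partial>circle_measure) =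
      (\<integral>t. (indicator {0..<2*pi} t / (2 * pi)) *\<^sub>R g (cis t) \<partial>lborel)"
    unfolding 1 using gc by (subst integral_density[symmetric]) (auto)
  also have "\<dots> = (\<integral>t. (1 / (2*pi)) *\<^sub>R (indicator {0..2*pi} t *\<^sub>R g (cis t)) \<partial>lborel)"
  proof (rule integral_cong_AE)
    show "AE t in lborel. (indicator {0..<2*pi} t / (2*pi)) *\<^sub>R g (cis t) =
        (1 / (2*pi)) *\<^sub>R (indicator {0..2*pi} t *\<^sub>R g (cis t))"
      using AE_lborel_singleton[of "2*pi"] by eventually_elim (auto simp: indicator_def)
  qed (use gc in measurable)
  also have "\<dots> = (1 / (2*pi)) *\<^sub>R (LINT t:{0..2*pi}|lborel. g (cis t))"
    unfolding set_lebesgue_integral_def by (rule integral_scaleR_right)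
  finally have 3: "(2*pi) *\<^sub>R (\<integral>\<zeta>. g \<zeta> \<partial>circle_measure) = (LINT t:{0..2*pi}|lborel. g (cis t))"
    by simp
  have "set_integrable lborel {0..2*pi} (\<lambda>t. g (cis t))"
    by (rule borel_integrable_atLeastAtMost') (rule cont)
  from set_borel_integral_eq_integral[OF this] show ?thesis
    unfolding 3 by (simp add: integrable_integral)
qed

lemma contour_integral_circle:
  assumes g: "continuous_on (sphere 0 1) g"
  shows "(g has_contour_integral (2 * of_real pi * \<i> * (\<integral>\<zeta>. \<zeta> * g \<zeta> \<partial>circle_measure))) (circlepath 0 1)"
proof -
  have "continuous_on (sphere 0 1) (\<lambda>\<zeta>. \<zeta> * g \<zeta>)"
    using g by (intro continuous_intros)
  from has_integral_mult_right[OF circle_integral_eq[OF this], of \<i>]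
  show ?thesis
    unfolding circlepath_def
    by (subst has_contour_integral_part_circlepath_iff) (auto simp: algebra_simps scaleR_conv_of_real)
qed

lemma Cauchy_circle:
  assumes F: "continuous_on (cball 0 1) F" "F holomorphic_on ball 0 1" and z: "norm z < 1"
  shows "(\<integral>\<zeta>. \<zeta> * (F \<zeta> / (\<zeta> - z)) \<partial>circle_measure) = F z"
proof -
  have "continuous_on (sphere 0 1) (\<lambda>\<zeta>. F \<zeta> / (\<zeta> - z))"
    using F z by (auto intro!: continuous_intros elim: continuous_on_subset)
  from has_contour_integral_unique[OF contour_integral_circle[OF this] Cauchy_integral_circlepath[OF F, of z]]
  show ?thesis using z by simp
qed

section \<open>Herglotz and Poisson integrals\<close>

text \<open>The real part of this kernel is the Poisson kernel. The kernel itself is holomorphic in \<open>z\<close>, so a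
Poisson integral is the real part of a holomorphic function that is at hand explicitly.\<close>

definition herglotz_kernel :: "complex \<Rightarrow> complex \<Rightarrow> complex" where
  "herglotz_kernel z \<zeta> = (\<zeta> + z) / (\<zeta> - z)"

definition herglotz :: "(complex \<Rightarrow> real) \<Rightarrow> complex \<Rightarrow> complex" where
  "herglotz v z = (\<integral>\<zeta>. herglotz_kernel z \<zeta> * of_real (v \<zeta>) \<partial>circle_measure)"

lemma continuous_on_herglotz_kernel [continuous_intros]:
  "norm z < 1 \<Longrightarrow> continuous_on (sphere 0 1) (herglotz_kernel z)"
  unfolding herglotz_kernel_def by (auto intro!: continuous_intros)

lemma Re_herglotz_kernel:
  assumes "norm \<zeta> = 1" 
  shows "Re (herglotz_kernel z \<zeta>) = (1 - (norm z)\<^sup>2) / (norm (\<zeta> - z))\<^sup>2"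
proof -
  have "(Re \<zeta>)\<^sup>2 + (Im \<zeta>)\<^sup>2 = 1"
    using assms by (simp add: cmod_def)
  then show ?thesis
    by (simp add: herglotz_kernel_def Re_divide cmod_power2) (simp add: power2_eq_square algebra_simps)
qed

lemma Re_herglotz_kernel_bounds:
  assumes "norm \<zeta> = 1" "norm z < 1"
  shows "0 \<le> Re (herglotz_kernel z \<zeta>)" "Re (herglotz_kernel z \<zeta>) \<le> 2 / (1 - norm z)"
proof -
  show "0 \<le> Re (herglotz_kernel z \<zeta>)"
    unfolding Re_herglotz_kernel[OF assms(1)] using assms(2) by (simp add: power_le_one)
  have *: "1 - norm z \<le> norm (\<zeta> - z)"
    using norm_triangle_ineq2[of \<zeta> z] assms by simp
  have "(1 - (norm z)\<^sup>2) / (norm (\<zeta> - z))\<^sup>2 \<le> (1 - (norm z)\<^sup>2) / (1 - norm z)\<^sup>2"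
    using assms * by (intro divide_left_mono power_mono mult_pos_pos zero_less_power) (auto simp: power_le_one)
  also have "\<dots> = (1 + norm z) / (1 - norm z)"
    using assms by (simp add: divide_simps power2_eq_square) (simp add: algebra_simps)
  also have "\<dots> \<le> 2 / (1 - norm z)"
    using assms by (intro divide_right_mono) auto
  finally show "Re (herglotz_kernel z \<zeta>) \<le> 2 / (1 - norm z)"
    unfolding Re_herglotz_kernel[OF assms(1)] .
qed

text \<open>Cauchy's formula applied to \<open>F w * (1 - \<bar>z\<bar>\<^sup>2) / (1 - cnj z * w)\<close>, whose value at \<open>z\<close> is \<open>F z\<close>: on the
circle \<open>1 - cnj z * \<zeta> = \<zeta> * cnj (\<zeta> - z)\<close>, which turns the Cauchy kernel into the Poisson kernel.\<close>

lemma Poisson_formula: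
  assumes F: "continuous_on (cball 0 1) F" "F holomorphic_on ball 0 1" and z: "norm z < 1"
  shows "(\<integral>\<zeta>. of_real (Re (herglotz_kernel z \<zeta>)) * F \<zeta> \<partial>circle_measure) = F z"
proof -
  define G where "G = (\<lambda>w. F w * of_real (1 - (norm z)\<^sup>2) / (1 - cnj z * w))"
  have nz: "1 - cnj z * w \<noteq> 0" if "norm w \<le> 1" for w
  proof
    assume "1 - cnj z * w = 0"
    then have "norm (cnj z * w) = 1" by (metis diff_eq_diff_eq diff_zero norm_one right_minus_eq)
    moreover have "norm z * norm w \<le> norm z * 1" using that by (intro mult_left_mono) auto
    ultimately show False using z by (simp add: norm_mult)
  qed
  have "continuous_on (cball 0 1) G" "G holomorphic_on ball 0 1"
    unfolding G_def using F nz by (auto intro!: continuous_intros holomorphic_intros)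
  from Cauchy_circle[OF this z] have "(\<integral>\<zeta>. \<zeta> * (G \<zeta> / (\<zeta> - z)) \<partial>circle_measure) = G z" .
  moreover have "G z = F z"
  proof -
    have "cnj z * z = of_real ((norm z)\<^sup>2)" by (metis complex_norm_square mult.commute)
    moreover have "1 - complex_of_real ((norm z)\<^sup>2) \<noteq> 0"
      using nz[of z] z calculation by auto
    ultimately show ?thesis by (simp add: G_def)
  qed
  moreover have "\<zeta> * (G \<zeta> / (\<zeta> - z)) = of_real (Re (herglotz_kernel z \<zeta>)) * F \<zeta>" if "norm \<zeta> = 1" for \<zeta>
  proof -
    have "\<zeta> * cnj \<zeta> = 1" using that by (simp add: complex_norm_square[symmetric])
    then have "\<zeta> * (cnj \<zeta> - cnj z) = 1 - cnj z * \<zeta>" by (simp add: algebra_simps)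
    moreover have "of_real ((norm (\<zeta> - z))\<^sup>2) = (\<zeta> - z) * (cnj \<zeta> - cnj z)"
      using complex_norm_square[of "\<zeta> - z"] by simp
    moreover have "\<zeta> \<noteq> 0" "\<zeta> - z \<noteq> 0" using that z by auto
    ultimately show ?thesis
      unfolding G_def Re_herglotz_kernel[OF that] using nz[of \<zeta>] that
      by (simp add: divide_simps)
  qed
  ultimately show ?thesis
    by (metis (mono_tags, lifting) Bochner_Integration.integral_cong mem_sphere_0 space_circle_measure)
qed

lemma mean_value_circle:
  assumes "continuous_on (cball 0 1) F" "F holomorphic_on ball 0 1"
  shows "(\<integral>\<zeta>. F \<zeta> \<partial>circle_measure) = F 0"
proof -
  have "(\<integral>\<zeta>. F \<zeta> \<partial>circle_measure) = (\<integral>\<zeta>. of_real (Re (herglotz_kernel 0 \<zeta>)) * F \<zeta> \<partial>circle_measure)"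
    by (rule Bochner_Integration.integral_cong) (auto simp: herglotz_kernel_def)
  then show ?thesis using Poisson_formula[OF assms, of 0] by simp
qed

lemma Re_herglotz:
  assumes "continuous_on (sphere 0 1) v" "norm z < 1"
  shows "Re (herglotz v z) = (\<integral>\<zeta>. Re (herglotz_kernel z \<zeta>) * v \<zeta> \<partial>circle_measure)"
proof -
  have "integrable circle_measure (\<lambda>\<zeta>. herglotz_kernel z \<zeta> * of_real (v \<zeta>))"
    using assms by (intro integrable_circle continuous_intros)
  then show ?thesis unfolding herglotz_def by (simp flip: integral_Re)
qed

text \<open>Since \<open>(\<zeta> + z) / (\<zeta> - z) = 2 * \<zeta> / (\<zeta> - z) - 1\<close>, a Herglotz integral is a Cauchy integral up to an
additive constant.\<close>

lemma herglotz_holomorphic: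
  assumes v: "continuous_on (sphere 0 1) v"
  shows "herglotz v holomorphic_on ball 0 1"
proof -
  define J where "J = (\<lambda>z. \<integral>\<zeta>. \<zeta> * (of_real (v \<zeta>) / (\<zeta> - z)) \<partial>circle_measure)"
  define C where "C = (\<lambda>z. 2 * of_real pi * \<i> * J z)"
  define c where "c = (\<integral>\<zeta>. complex_of_real (v \<zeta>) \<partial>circle_measure)"
  have cont: "continuous_on (sphere 0 1) (\<lambda>\<zeta>. of_real (v \<zeta>) / (\<zeta> - z))" if "norm z < 1" for z
    using v that by (auto intro!: continuous_intros)
  have "((\<lambda>u. of_real (v u) / (u - z)^1) has_contour_integral C z) (circlepath 0 1)" if "z \<in> ball 0 1" for z
    unfolding C_def J_def using contour_integral_circle[OF cont] that by simp
  from Cauchy_next_derivative_circlepath(2)[OF _ this] have "C holomorphic_on ball 0 1"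
    using v unfolding holomorphic_on_open[OF open_ball] by (fastforce intro!: continuous_intros)
  then have hol: "(\<lambda>z. C z / (of_real pi * \<i>) - c) holomorphic_on ball 0 1"
    by (intro holomorphic_intros) auto
  have eq: "herglotz v z = C z / (of_real pi * \<i>) - c" if z: "z \<in> ball 0 1" for z
  proof -
    have i1: "integrable circle_measure (\<lambda>\<zeta>. 2 * (\<zeta> * (complex_of_real (v \<zeta>) / (\<zeta> - z))))"
      using cont z v by (intro integrable_circle continuous_intros) auto
    have i2: "integrable circle_measure (\<lambda>\<zeta>. complex_of_real (v \<zeta>))"
      using v by (intro integrable_circle continuous_intros)
    have "(\<zeta> + z) / (\<zeta> - z) * c = 2 * (\<zeta> * (c / (\<zeta> - z))) - c" if "norm \<zeta> = 1" for \<zeta> c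
    proof -
      have "\<zeta> - z \<noteq> 0" using that z by auto
      then show ?thesis by (simp add: divide_simps) (simp add: algebra_simps)
    qed
    then have "herglotz v z = (\<integral>\<zeta>. 2 * (\<zeta> * (of_real (v \<zeta>) / (\<zeta> - z))) - of_real (v \<zeta>) \<partial>circle_measure)"
      unfolding herglotz_def herglotz_kernel_def
      by (intro Bochner_Integration.integral_cong) auto
    also have "\<dots> = 2 * J z - c"
      unfolding c_def J_def Bochner_Integration.integral_diff[OF i1 i2]
      by (subst integral_mult_right_zero) (rule refl)
    finally show ?thesis unfolding C_def by simp
  qed
  show ?thesis
    by (rule holomorphic_transform[OF hol]) (simp add: eq)
qed

section \<open>Subharmonicity of powers of the modulus\<close>

lemma circle_integral_tendsto:
  fixes g :: "complex \<Rightarrow> 'b::{banach,second_countable_topology}"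
  assumes "\<And>n. continuous_on (sphere 0 1) (s n)" "continuous_on (sphere 0 1) g"
    and "\<And>n \<zeta>. norm \<zeta> = 1 \<Longrightarrow> norm (s n \<zeta>) \<le> B"
    and "\<And>\<zeta>. norm \<zeta> = 1 \<Longrightarrow> (\<lambda>n. s n \<zeta>) \<longlonglongrightarrow> g \<zeta>"
  shows "(\<lambda>n. \<integral>\<zeta>. s n \<zeta> \<partial>circle_measure) \<longlonglongrightarrow> (\<integral>\<zeta>. g \<zeta> \<partial>circle_measure)"
  by (rule integral_dominated_convergence[where w="\<lambda>_. B"])
     (use assms in \<open>auto intro!: borel_measurable_circle AE_I2\<close>)

lemma powr_norm_tendsto:
  fixes l :: "'a::real_normed_vector"
  assumes "(f \<longlongrightarrow> l) F" "0 < t"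
  shows "((\<lambda>x. norm (f x) powr t) \<longlongrightarrow> norm l powr t) F"
  using assms by (intro tendsto_powr' tendsto_intros) auto

lemma continuous_on_powr_norm [continuous_intros]:
  fixes f :: "'a::topological_space \<Rightarrow> 'b::real_normed_vector"
  assumes "continuous_on S f" "0 < t"
  shows "continuous_on S (\<lambda>x. norm (f x) powr t)"
  using assms by (intro continuous_on_powr' continuous_intros) auto

text \<open>Without zeros, \<open>g = exp u\<close>, and \<open>\<bar>g\<bar>\<close> to the power \<open>t\<close> is the modulus of the holomorphic function
\<open>exp (t * u)\<close>, to which the Poisson formula applies. As \<open>u\<close> need not extend to the closed disc, the
formula is used on smaller discs, whose radii tend to 1.\<close>

lemma zero_free_norm_powr_le_herglotz:
  assumes g: "continuous_on (cball 0 1) g" "g holomorphic_on ball 0 1"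
    and nz: "\<And>w. norm w < 1 \<Longrightarrow> g w \<noteq> 0" and t: "0 < t" and z: "norm z < 1"
  shows "norm (g z) powr t \<le> Re (herglotz (\<lambda>\<zeta>. norm (g \<zeta>) powr t) z)"
proof -
  obtain u where u: "u holomorphic_on ball 0 1" "\<And>w. w \<in> ball 0 1 \<Longrightarrow> g w = exp (u w)"
    using contractible_imp_holomorphic_log[OF g(2) convex_imp_contractible] nz
    by (metis convex_ball mem_ball_0)
  have gpow: "norm (exp (of_real t * u w)) = norm (g w) powr t" if "norm w < 1" for w
    using u(2)[of w] that by (simp add: powr_def)
  define \<rho> where "\<rho> = (\<lambda>n. real n / real (Suc n))"
  have \<rho>: "0 \<le> \<rho> n" "\<rho> n < 1" for n by (auto simp: \<rho>_def)
  have \<rho>lim: "\<rho> \<longlonglongrightarrow> 1" unfolding \<rho>_def by (rule LIMSEQ_n_over_Suc_n)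
  have in_disc: "norm (of_real (\<rho> n) * w) < 1" if "norm w \<le> 1" for n and w :: complex
    using \<rho>[of n] that mult_left_le[of "norm w" "\<rho> n"] by (simp add: norm_mult)
  have in_cdisc: "of_real (\<rho> n) * w \<in> cball 0 1" if "norm w \<le> 1" for n and w :: complex
    using in_disc[OF that] by (simp add: less_imp_le)
  obtain B where B: "\<And>w. w \<in> cball 0 1 \<Longrightarrow> norm (g w) \<le> B"
    using compact_continuous_image[OF g(1) compact_cball] by (meson bounded_iff compact_imp_bounded imageI)
  have contg: "continuous_on (sphere 0 1) (\<lambda>\<zeta>. g (of_real (\<rho> n) * \<zeta>))" for n
    by (rule continuous_on_compose2[OF g(1)]) (use in_cdisc in \<open>auto intro!: continuous_intros\<close>)
  have cont: "continuous_on (sphere 0 1)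
      (\<lambda>\<zeta>. Re (herglotz_kernel z \<zeta>) * norm (g (of_real (\<rho> n) * \<zeta>)) powr t)" for n
    using contg z t by (intro continuous_intros)
  have le: "norm (g (of_real (\<rho> n) * z)) powr t
      \<le> (\<integral>\<zeta>. Re (herglotz_kernel z \<zeta>) * norm (g (of_real (\<rho> n) * \<zeta>)) powr t \<partial>circle_measure)" for n
  proof -
    \<comment> \<open>The modulus of F is the power of the modulus of the dilate of g.\<close>
    define F where "F = (\<lambda>w. exp (of_real t * u (of_real (\<rho> n) * w)))"
    have "(\<lambda>w. u (of_real (\<rho> n) * w)) holomorphic_on cball 0 1"
      by (rule holomorphic_on_compose_gen[of "\<lambda>w. of_real (\<rho> n) * w" "cball 0 1" u "ball 0 1", unfolded o_def])
         (use u(1) in_disc in \<open>auto intro!: holomorphic_intros\<close>)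
    then have F: "F holomorphic_on cball 0 1"
      unfolding F_def by (intro holomorphic_intros)
    have Fn: "norm (F w) = norm (g (of_real (\<rho> n) * w)) powr t" if "norm w \<le> 1" for w
      unfolding F_def by (rule gpow[OF in_disc[OF that]])
    have "norm (g (of_real (\<rho> n) * z)) powr t = norm (F z)"
      using Fn[of z] z by simp
    also have "F z = (\<integral>\<zeta>. of_real (Re (herglotz_kernel z \<zeta>)) * F \<zeta> \<partial>circle_measure)"
      using Poisson_formula[of F z] F z holomorphic_on_imp_continuous_on holomorphic_on_subset ball_subset_cball
      by metis
    also have "norm \<dots> \<le> (\<integral>\<zeta>. norm (of_real (Re (herglotz_kernel z \<zeta>)) * F \<zeta>) \<partial>circle_measure)"
      by (rule integral_norm_bound)
    also have "\<dots> = (\<integral>\<zeta>. Re (herglotz_kernel z \<zeta>) * norm (g (of_real (\<rho> n) * \<zeta>)) powr t \<partial>circle_measure)"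
      by (rule Bochner_Integration.integral_cong)
         (auto simp: norm_mult Fn Re_herglotz_kernel_bounds(1)[OF _ z])
    finally show ?thesis .
  qed
  have lim: "(\<lambda>n. norm (g (of_real (\<rho> n) * w)) powr t) \<longlonglongrightarrow> norm (g w) powr t" if "norm w \<le> 1" for w
  proof (rule powr_norm_tendsto[OF _ t])
    have "(\<lambda>n. of_real (\<rho> n) * w) \<longlonglongrightarrow> of_real 1 * w"
      by (intro tendsto_intros \<rho>lim)
    then show "(\<lambda>n. g (of_real (\<rho> n) * w)) \<longlonglongrightarrow> g w"
      using that in_cdisc[OF that] by (intro continuous_on_tendsto_compose[OF g(1)]) auto
  qed
  have "(\<lambda>n. \<integral>\<zeta>. Re (herglotz_kernel z \<zeta>) * norm (g (of_real (\<rho> n) * \<zeta>)) powr t \<partial>circle_measure)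
     \<longlonglongrightarrow> (\<integral>\<zeta>. Re (herglotz_kernel z \<zeta>) * norm (g \<zeta>) powr t \<partial>circle_measure)"
  proof (rule circle_integral_tendsto[where B="2 / (1 - norm z) * B powr t"])
    show "continuous_on (sphere 0 1) (\<lambda>\<zeta>. Re (herglotz_kernel z \<zeta>) * norm (g \<zeta>) powr t)"
      using z t by (intro continuous_intros continuous_on_subset[OF g(1)]) auto
  next
    fix n and \<zeta> :: complex assume \<zeta>: "norm \<zeta> = 1"
    have "norm (g (of_real (\<rho> n) * \<zeta>)) powr t \<le> B powr t"
      using B[OF in_cdisc, of \<zeta> n] \<zeta> t by (intro powr_mono2) auto
    then show "norm (Re (herglotz_kernel z \<zeta>) * norm (g (of_real (\<rho> n) * \<zeta>)) powr t) \<le> 2 / (1 - norm z) * B powr t"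
      unfolding real_norm_def abs_mult using z Re_herglotz_kernel_bounds[OF \<zeta> z]
      by (intro mult_mono) auto
  qed (use cont lim in \<open>auto intro!: tendsto_mult_left\<close>)
  from LIMSEQ_le[OF lim[of z] this] le z
  have "norm (g z) powr t \<le> (\<integral>\<zeta>. Re (herglotz_kernel z \<zeta>) * norm (g \<zeta>) powr t \<partial>circle_measure)"
    by auto
  moreover have "continuous_on (sphere 0 1) (\<lambda>\<zeta>. norm (g \<zeta>) powr t)"
    using t by (intro continuous_intros continuous_on_subset[OF g(1)]) auto
  ultimately show ?thesis by (simp add: Re_herglotz z)
qed

lemma norm_reflection:
  fixes a z :: complex
  shows "(norm (1 - z * cnj a))\<^sup>2 - (norm (z - a))\<^sup>2 = (1 - (norm a)\<^sup>2) * (1 - (norm z)\<^sup>2)"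
  by (simp add: cmod_power2) (simp add: power2_eq_square algebra_simps)

text \<open>Reflecting a zero \<open>a\<close> in the disc at the circle, that is, replacing the factor \<open>z - a\<close> by
\<open>1 - z * cnj a\<close>, keeps the modulus on the circle and does not decrease it inside. Working with
polynomials makes the number of zeros finite and replaces Blaschke products.\<close>

lemma poly_reflect_zeros:
  fixes p :: "complex poly"
  assumes "p \<noteq> 0"
  shows "\<exists>g. (\<forall>z. norm z < 1 \<longrightarrow> poly g z \<noteq> 0) \<and> (\<forall>z. norm z = 1 \<longrightarrow> norm (poly g z) = norm (poly p z)) \<and>
             (\<forall>z. norm z < 1 \<longrightarrow> norm (poly p z) \<le> norm (poly g z))"
  using assms
proof (induction "degree p" arbitrary: p)
  case 0
  then obtain c where "p = [:c:]" "c \<noteq> 0" by (metis degree_eq_zeroE pCons_0_0)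
  then show ?case by (intro exI[of _ p]) auto
next
  case (Suc n)
  have "coeff p 0 = 0 \<or> (\<exists>i\<in>{1..degree p}. coeff p i \<noteq> 0)"
    using Suc.hyps(2) by (metis atLeastAtMost_iff degree_0 leading_coeff_0_iff le_refl One_nat_def Suc_le_mono zero_le nat.simps(3))
  then obtain a where "(\<Sum>i\<le>degree p. coeff p i * a ^ i) = 0"
    by (rule Cauchy_Integral_Formula.fundamental_theorem_of_algebra)
  then have "poly p a = 0" by (simp add: poly_altdef)
  then obtain q where q: "p = [:-a, 1:] * q"
    by (metis dvdE poly_eq_0_iff_dvd)
  with Suc.prems have "q \<noteq> 0" by auto
  moreover have "n = degree q"
    using Suc.hyps(2) \<open>q \<noteq> 0\<close> unfolding q by (subst (asm) degree_mult_eq) auto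
  ultimately obtain g where g: "\<And>z. norm z < 1 \<Longrightarrow> poly g z \<noteq> 0"
      "\<And>z. norm z = 1 \<Longrightarrow> norm (poly g z) = norm (poly q z)"
      "\<And>z. norm z < 1 \<Longrightarrow> norm (poly q z) \<le> norm (poly g z)"
    using Suc.hyps(1) by metis
  show ?case
  proof (cases "norm a < 1")
    case False
    have "poly ([:-a, 1:] * h) w = (w - a) * poly h w" for h w
      by (simp add: algebra_simps)
    with False show ?thesis
      using g unfolding q
      by (intro exI[of _ "[:-a, 1:] * g"]) (auto simp: norm_mult simp del: mult_pCons_left intro!: mult_left_mono)
  next
    case True
    have eq: "norm (1 - z * cnj a) = norm (z - a)" if "norm z = 1" for z
    proof (rule power2_eq_imp_eq)
      have "(norm (1 - z * cnj a))\<^sup>2 - (norm (z - a))\<^sup>2 = 0"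
        unfolding norm_reflection using that by simp
      then show "(norm (1 - z * cnj a))\<^sup>2 = (norm (z - a))\<^sup>2" by linarith
    qed simp_all
    have le: "norm (z - a) \<le> norm (1 - z * cnj a)" if "norm z < 1" for z
    proof -
      have "0 \<le> (1 - (norm a)\<^sup>2) * (1 - (norm z)\<^sup>2)"
        using that True power_le_one[of "norm a" 2] power_le_one[of "norm z" 2]
        by (intro mult_nonneg_nonneg) simp_all
      then have "(norm (z - a))\<^sup>2 \<le> (norm (1 - z * cnj a))\<^sup>2" using norm_reflection[of z a] by linarith
      then show ?thesis by (rule power2_le_imp_le) simp
    qed
    have nz: "1 - z * cnj a \<noteq> 0" if "norm z < 1" for z
    proof
      assume "1 - z * cnj a = 0"
      then have "norm (z * cnj a) = 1" by (metis diff_eq_diff_eq diff_zero norm_one right_minus_eq)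
      moreover have "norm a * norm z \<le> norm a * 1" using that by (intro mult_left_mono) auto
      ultimately show False using True by (simp add: norm_mult mult.commute)
    qed
    have "poly ([:-a, 1:] * h) w = (w - a) * poly h w"
      "poly ([:1, - cnj a:] * h) w = (1 - w * cnj a) * poly h w" for h w
      by (simp_all add: algebra_simps)
    then show ?thesis
      using g eq le nz unfolding q
      by (intro exI[of _ "[:1, - cnj a:] * g"])
         (auto simp: norm_mult simp del: mult_pCons_left intro!: mult_mono)
  qed
qed

lemma poly_norm_powr_le_herglotz:
  fixes p :: "complex poly"
  assumes t: "0 < t" and z: "norm z < 1"
  shows "norm (poly p z) powr t \<le> Re (herglotz (\<lambda>\<zeta>. norm (poly p \<zeta>) powr t) z)"
proof (cases "p = 0")
  case True
  then show ?thesis by (simp add: herglotz_def)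
next
  case False
  then obtain g where g: "\<And>z. norm z < 1 \<Longrightarrow> poly g z \<noteq> 0"
      "\<And>z. norm z = 1 \<Longrightarrow> norm (poly g z) = norm (poly p z)"
      "\<And>z. norm z < 1 \<Longrightarrow> norm (poly p z) \<le> norm (poly g z)"
    using poly_reflect_zeros by metis
  have "norm (poly p z) powr t \<le> norm (poly g z) powr t"
    using g(3)[OF z] t by (intro powr_mono2) auto
  also have "\<dots> \<le> Re (herglotz (\<lambda>\<zeta>. norm (poly g \<zeta>) powr t) z)"
    by (rule zero_free_norm_powr_le_herglotz) (use g t z in \<open>auto intro!: continuous_intros holomorphic_intros\<close>)
  also have "herglotz (\<lambda>\<zeta>. norm (poly g \<zeta>) powr t) z = herglotz (\<lambda>\<zeta>. norm (poly p \<zeta>) powr t) z"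
    unfolding herglotz_def by (rule Bochner_Integration.integral_cong) (auto simp: g(2))
  finally show ?thesis .
qed

text \<open>The power of the modulus of a holomorphic function lies below its Poisson integral, for every
positive exponent. For exponents below 1 this is not a consequence of convexity: the polynomial case
relies on the reflection of zeros, and Taylor polynomials give the general case.\<close>

lemma norm_powr_le_herglotz:
  assumes f: "f holomorphic_on ball 0 R" and R: "1 < R" and t: "0 < t" and z: "norm z < 1"
  shows "norm (f z) powr t \<le> Re (herglotz (\<lambda>\<zeta>. norm (f \<zeta>) powr t) z)"
proof -
  define a where "a = (\<lambda>n. (deriv ^^ n) f 0 / fact n)"
  define P where "P = (\<lambda>n. \<Sum>k<n. monom (a k) k)"
  have sums: "(\<lambda>n. a n * w ^ n) sums f w" if "norm w < R" for w
    using holomorphic_power_series[OF f, of w] that by (simp add: a_def)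
  have polyP: "poly (P n) w = (\<Sum>k<n. a k * w ^ k)" for n w
    by (simp add: P_def poly_sum poly_monom)
  have limP: "(\<lambda>n. poly (P n) w) \<longlonglongrightarrow> f w" if "norm w \<le> 1" for w
    using sums[of w] that R unfolding sums_def polyP by simp
  \<comment> \<open>The power series converges absolutely at 1, as it converges at the larger point (1 + R) / 2; this bounds
    all Taylor polynomials on the closed disc at once.\<close>
  have "summable (\<lambda>n. norm (a n * 1 ^ n))"
    by (rule powser_insidea[where x="of_real ((1 + R) / 2)"])
       (use sums[of "of_real ((1 + R) / 2)"] R in \<open>auto simp: sums_iff simp del: of_real_divide of_real_add\<close>)
  then have summ: "summable (\<lambda>n. norm (a n))" by simp
  define B where "B = (\<Sum>n. norm (a n))"
  have boundP: "norm (poly (P n) w) \<le> B" if "norm w \<le> 1" for n w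
  proof -
    have "norm (poly (P n) w) \<le> (\<Sum>k<n. norm (a k * w ^ k))" unfolding polyP by (rule norm_sum)
    also have "\<dots> \<le> (\<Sum>k<n. norm (a k))"
      using that by (intro sum_mono) (auto simp: norm_mult norm_power intro!: mult_left_le power_le_one)
    also have "\<dots> \<le> B" unfolding B_def by (rule sum_le_suminf[OF summ]) auto
    finally show ?thesis .
  qed
  have contf: "continuous_on (sphere 0 1) f"
    using holomorphic_on_imp_continuous_on[OF f] by (rule continuous_on_subset) (use R in auto)
  have "(\<lambda>n. \<integral>\<zeta>. Re (herglotz_kernel z \<zeta>) * norm (poly (P n) \<zeta>) powr t \<partial>circle_measure)
     \<longlonglongrightarrow> (\<integral>\<zeta>. Re (herglotz_kernel z \<zeta>) * norm (f \<zeta>) powr t \<partial>circle_measure)"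
  proof (rule circle_integral_tendsto[where B="2 / (1 - norm z) * B powr t"])
    fix n and \<zeta> :: complex assume \<zeta>: "norm \<zeta> = 1"
    have "norm (poly (P n) \<zeta>) powr t \<le> B powr t"
      using boundP[of \<zeta> n] \<zeta> t by (intro powr_mono2) auto
    then show "norm (Re (herglotz_kernel z \<zeta>) * norm (poly (P n) \<zeta>) powr t) \<le> 2 / (1 - norm z) * B powr t"
      unfolding real_norm_def abs_mult using z Re_herglotz_kernel_bounds[OF \<zeta> z]
      by (intro mult_mono) auto
  next
    fix \<zeta> :: complex assume "norm \<zeta> = 1"
    then show "(\<lambda>n. Re (herglotz_kernel z \<zeta>) * norm (poly (P n) \<zeta>) powr t) \<longlonglongrightarrow> Re (herglotz_kernel z \<zeta>) * norm (f \<zeta>) powr t"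
      using t by (intro tendsto_mult_left powr_norm_tendsto limP) auto
  qed (use z t contf in \<open>auto intro!: continuous_intros\<close>)
  moreover have "norm (poly (P n) z) powr t \<le> (\<integral>\<zeta>. Re (herglotz_kernel z \<zeta>) * norm (poly (P n) \<zeta>) powr t \<partial>circle_measure)" for n
    using poly_norm_powr_le_herglotz[OF t z, of "P n"] t z
    by (subst (asm) Re_herglotz) (auto intro!: continuous_intros)
  ultimately have "norm (f z) powr t \<le> (\<integral>\<zeta>. Re (herglotz_kernel z \<zeta>) * norm (f \<zeta>) powr t \<partial>circle_measure)"
    using z t by (intro LIMSEQ_le[OF powr_norm_tendsto[OF limP]]) auto
  then show ?thesis using z t contf by (subst Re_herglotz) (auto intro!: continuous_intros)
qed

lemma Re_herglotz_le:
  assumes v: "continuous_on (sphere 0 1) v" "\<And>\<zeta>. norm \<zeta> = 1 \<Longrightarrow> 0 \<le> v \<zeta>" and z: "norm z < 1"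
  shows "Re (herglotz v z) \<le> 2 / (1 - norm z) * (\<integral>\<zeta>. v \<zeta> \<partial>circle_measure)"
proof -
  have "(\<integral>\<zeta>. Re (herglotz_kernel z \<zeta>) * v \<zeta> \<partial>circle_measure) \<le> (\<integral>\<zeta>. 2 / (1 - norm z) * v \<zeta> \<partial>circle_measure)"
    using v z Re_herglotz_kernel_bounds[OF _ z]
    by (intro integral_mono integrable_circle continuous_intros mult_right_mono) auto
  then show ?thesis
    unfolding Re_herglotz[OF v(1) z] by (subst (asm) integral_mult_right_zero)
qed

section \<open>Circle means and subordination\<close>

definition hardy_mean :: "real \<Rightarrow> (complex \<Rightarrow> complex) \<Rightarrow> real \<Rightarrow> real" where
  "hardy_mean p f r = (\<integral>\<zeta>. norm (f (of_real r * \<zeta>)) powr p \<partial>circle_measure)"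

text \<open>For a holomorphic function, \<open>hardy_le p f K\<close> is the bound \<open>K\<close> on the \<open>p\<close>-th power of the Hardy
quasi-norm, expressed with real integrals; it depends only on the values of \<open>f\<close> in the disc.\<close>

definition hardy_le :: "real \<Rightarrow> (complex \<Rightarrow> complex) \<Rightarrow> real \<Rightarrow> bool" where
  "hardy_le p f K \<longleftrightarrow> (\<forall>r. 0 < r \<longrightarrow> r < 1 \<longrightarrow> hardy_mean p f r \<le> K)"

lemma norm_scale_less:
  fixes z :: complex
  assumes "0 < r" "r < 1" "norm z \<le> 1"
  shows "norm (of_real r * z) < 1"
proof -
  have "r * norm z \<le> r * 1" using assms by (intro mult_left_mono) auto
  moreover have "norm (of_real r * z) = r * norm z" using assms by (simp add: norm_mult)
  ultimately show ?thesis using assms by linarith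
qed

lemma continuous_on_dilate:
  assumes "f holomorphic_on ball 0 1" "0 < r" "r < 1"
  shows "continuous_on (cball 0 1) (\<lambda>z. f (of_real r * z))"
  by (rule continuous_on_compose2[OF holomorphic_on_imp_continuous_on[OF assms(1)]])
     (use norm_scale_less[OF assms(2,3)] in \<open>auto intro!: continuous_intros\<close>)

lemma holomorphic_on_dilate:
  assumes "f holomorphic_on ball 0 1" "0 < r" "r < 1"
  shows "(\<lambda>z. f (of_real r * z)) holomorphic_on cball 0 1"
  by (rule holomorphic_on_compose_gen[of "\<lambda>w. of_real r * w" "cball 0 1" f "ball 0 1", unfolded o_def])
     (use assms norm_scale_less[OF assms(2,3)] in \<open>auto intro!: holomorphic_intros\<close>)

lemma self_map_less:
  "holomorphic_self_map \<phi> \<Longrightarrow> norm z < 1 \<Longrightarrow> norm (\<phi> z) < 1"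
  by (simp add: holomorphic_self_map_def image_subset_iff)

lemma holomorphic_on_compose_self_map:
  assumes "f holomorphic_on ball 0 1" "holomorphic_self_map \<phi>"
  shows "(\<lambda>z. f (\<phi> z)) holomorphic_on ball 0 1"
  using holomorphic_on_compose_gen[of \<phi> "ball 0 1" f "ball 0 1"] assms
  by (auto simp: holomorphic_self_map_def o_def)

lemma self_map_radius:
  assumes "holomorphic_self_map \<phi>" "0 < r" "r < 1"
  obtains \<rho> where "\<rho> < 1" "\<And>\<zeta>. norm \<zeta> \<le> 1 \<Longrightarrow> norm (\<phi> (of_real r * \<zeta>)) \<le> \<rho>"
proof -
  have "continuous_on (cball 0 1) (\<lambda>\<zeta>. norm (\<phi> (of_real r * \<zeta>)))"
    using assms by (intro continuous_intros continuous_on_dilate) (auto simp: holomorphic_self_map_def)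
  from continuous_attains_sup[OF compact_cball _ this]
  obtain \<zeta>0 :: complex where z0: "norm \<zeta>0 \<le> 1"
    "\<And>\<zeta>. norm \<zeta> \<le> 1 \<Longrightarrow> norm (\<phi> (of_real r * \<zeta>)) \<le> norm (\<phi> (of_real r * \<zeta>0))" by auto
  have "norm (\<phi> (of_real r * \<zeta>0)) < 1"
    by (intro self_map_less[OF assms(1)] norm_scale_less assms z0)
  then show ?thesis
    using that z0(2) by blast
qed

text \<open>Statements about functions holomorphic near the closed disc pass to all holomorphic functions on the
disc by letting the dilation factor tend to 1, with dominated convergence on the circles involved.\<close>

lemma dilate_limit:
  assumes f: "f holomorphic_on ball 0 1" and \<rho>: "\<rho> < 1"
  obtains s :: "nat \<Rightarrow> real" and B where "\<And>n. 0 < s n" "\<And>n. s n < 1"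
    "\<And>n w. norm w \<le> \<rho> \<Longrightarrow> norm (f (of_real (s n) * w)) \<le> B"
    "\<And>w. norm w \<le> \<rho> \<Longrightarrow> (\<lambda>n. f (of_real (s n) * w)) \<longlonglongrightarrow> f w"
proof -
  define s where "s = (\<lambda>n. real (Suc n) / real (Suc (Suc n)))"
  have s: "0 < s n" "s n < 1" for n by (auto simp: s_def)
  have lim: "s \<longlonglongrightarrow> 1"
    unfolding s_def by (rule LIMSEQ_Suc[OF LIMSEQ_n_over_Suc_n])
  have cont: "continuous_on (cball 0 \<rho>) f"
    using holomorphic_on_imp_continuous_on[OF f] by (rule continuous_on_subset) (use \<rho> in auto)
  obtain B where B: "\<And>w. w \<in> cball 0 \<rho> \<Longrightarrow> norm (f w) \<le> B"
    using compact_continuous_image[OF cont compact_cball] by (meson bounded_iff compact_imp_bounded imageI)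
  have mem: "of_real (s n) * w \<in> cball 0 \<rho>" if "norm w \<le> \<rho>" for n and w :: complex
    using s[of n] that mult_right_mono[of "s n" 1 "norm w"] by (simp add: norm_mult)
  have "(\<lambda>n. f (of_real (s n) * w)) \<longlonglongrightarrow> f w" if "norm w \<le> \<rho>" for w
  proof (rule continuous_on_tendsto_compose[OF cont])
    have "(\<lambda>n. of_real (s n) * w) \<longlonglongrightarrow> of_real 1 * w" by (intro tendsto_intros lim)
    then show "(\<lambda>n. of_real (s n) * w) \<longlonglongrightarrow> w" by simp
  qed (use that mem in auto)
  with s B mem show ?thesis by (intro that[of s B]) auto
qed

lemma dilate_norm_powr_le_herglotz:
  assumes "f holomorphic_on ball 0 1" "0 < s" "s < 1" "0 < t" "norm z < 1"
  shows "norm (f (of_real s * z)) powr t \<le> Re (herglotz (\<lambda>\<zeta>. norm (f (of_real s * \<zeta>)) powr t) z)"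
proof (rule norm_powr_le_herglotz[of "\<lambda>z. f (of_real s * z)" "1 / s"])
  show "(\<lambda>z. f (of_real s * z)) holomorphic_on ball 0 (1 / s)"
    by (rule holomorphic_on_compose_gen[of "\<lambda>w. of_real s * w" "ball 0 (1/s)" f "ball 0 1", unfolded o_def])
       (use assms in \<open>auto simp: norm_mult field_simps intro!: holomorphic_intros\<close>)
qed (use assms in auto)

lemma continuous_on_dilate_powr:
  assumes "f holomorphic_on ball 0 1" "0 < s" "s < 1" "0 < t"
  shows "continuous_on (sphere 0 1) (\<lambda>\<zeta>. norm (f (of_real s * \<zeta>)) powr t)"
  using assms by (intro continuous_intros continuous_on_subset[OF continuous_on_dilate[OF assms(1-3)]]) auto

lemma hardy_point_estimate:
  assumes f: "f holomorphic_on ball 0 1" and p: "0 < p" and K: "hardy_le p f K" and w: "norm w < 1"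
  shows "norm (f w) powr p \<le> 2 / (1 - norm w) * K"
proof -
  obtain s B where s: "\<And>n. 0 < s n" "\<And>n. s n < 1"
    "\<And>v. norm v \<le> norm w \<Longrightarrow> (\<lambda>n. f (of_real (s n) * v)) \<longlonglongrightarrow> f v"
    using dilate_limit[OF f w] by metis
  have "norm (f (of_real (s n) * w)) powr p \<le> 2 / (1 - norm w) * K" for n
  proof -
    have "norm (f (of_real (s n) * w)) powr p \<le> Re (herglotz (\<lambda>\<zeta>. norm (f (of_real (s n) * \<zeta>)) powr p) w)"
      by (rule dilate_norm_powr_le_herglotz) (use f s p w in auto)
    also have "\<dots> \<le> 2 / (1 - norm w) * hardy_mean p f (s n)"
      unfolding hardy_mean_def
      by (rule Re_herglotz_le) (use f s p w in \<open>auto intro!: continuous_on_dilate_powr\<close>)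
    also have "\<dots> \<le> 2 / (1 - norm w) * K"
      using K s w unfolding hardy_le_def by (intro mult_left_mono) auto
    finally show ?thesis .
  qed
  then show ?thesis
    using powr_norm_tendsto[OF s(3)[OF order_refl] p] by (intro LIMSEQ_le_const2) auto
qed

lemma mean_value_self_map:
  assumes "H holomorphic_on ball 0 1" "holomorphic_self_map \<phi>" "0 < r" "r < 1"
  shows "(\<integral>\<zeta>. H (\<phi> (of_real r * \<zeta>)) \<partial>circle_measure) = H (\<phi> 0)"
proof -
  have "(\<lambda>z. H (\<phi> (of_real r * z))) holomorphic_on cball 0 1"
    by (rule holomorphic_on_dilate[OF holomorphic_on_compose_self_map[OF assms(1,2)] assms(3,4)])
  from mean_value_circle[OF holomorphic_on_imp_continuous_on[OF this] holomorphic_on_subset[OF this ball_subset_cball]]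
  show ?thesis by simp
qed

lemma mean_value_self_map_Re:
  assumes "H holomorphic_on ball 0 1" "holomorphic_self_map \<phi>" "0 < r" "r < 1"
  shows "(\<integral>\<zeta>. Re (H (\<phi> (of_real r * \<zeta>))) \<partial>circle_measure) = Re (H (\<phi> 0))"
    and "integrable circle_measure (\<lambda>\<zeta>. H (\<phi> (of_real r * \<zeta>)))"
proof -
  show int: "integrable circle_measure (\<lambda>\<zeta>. H (\<phi> (of_real r * \<zeta>)))"
    by (rule integrable_circle, rule continuous_on_subset,
        rule continuous_on_dilate[OF holomorphic_on_compose_self_map[OF assms(1,2)] assms(3,4)]) auto
  show "(\<integral>\<zeta>. Re (H (\<phi> (of_real r * \<zeta>))) \<partial>circle_measure) = Re (H (\<phi> 0))"
    using integral_Re[OF int] mean_value_self_map[OF assms] by simp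
qed

text \<open>Let \<open>H\<close> be the Herglotz integral of \<open>\<bar>f\<bar>\<close> to the power \<open>p\<close> on a circle. Then \<open>Re H\<close> majorizes that
power inside, and since \<open>H \<circ> \<phi>\<close> is again holomorphic, its mean over a circle is its value at 0, where
the Poisson kernel at \<open>\<phi> 0\<close> gives the constant.\<close>

lemma littlewood_subordination:
  assumes f: "f holomorphic_on ball 0 1" and p: "0 < p" and K: "hardy_le p f K"
    and \<phi>: "holomorphic_self_map \<phi>"
  shows "hardy_le p (\<lambda>z. f (\<phi> z)) (2 / (1 - norm (\<phi> 0)) * K)"
  unfolding hardy_le_def
proof (intro allI impI)
  fix r :: real assume r: "0 < r" "r < 1"
  have \<phi>0: "norm (\<phi> 0) < 1" using self_map_less[OF \<phi>] by simp
  obtain \<rho> where \<rho>: "\<rho> < 1" "\<And>\<zeta>. norm \<zeta> \<le> 1 \<Longrightarrow> norm (\<phi> (of_real r * \<zeta>)) \<le> \<rho>"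
    using self_map_radius[OF \<phi> r] by metis
  obtain s B where s: "\<And>n. 0 < s n" "\<And>n. s n < 1"
    and B: "\<And>n w. norm w \<le> \<rho> \<Longrightarrow> norm (f (of_real (s n) * w)) \<le> B"
    and lim: "\<And>w. norm w \<le> \<rho> \<Longrightarrow> (\<lambda>n. f (of_real (s n) * w)) \<longlonglongrightarrow> f w"
    using dilate_limit[OF f \<rho>(1)] by metis
  have hol: "(\<lambda>z. f (of_real (s n) * z)) holomorphic_on ball 0 1" for n
    using holomorphic_on_subset[OF holomorphic_on_dilate[OF f s]] by auto
  have cont: "continuous_on (sphere 0 1) (\<lambda>\<zeta>. norm (f (of_real (s n) * \<phi> (of_real r * \<zeta>))) powr p)" for n
    using continuous_on_dilate_powr[OF holomorphic_on_compose_self_map[OF hol \<phi>] r p] .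
  have "(\<integral>\<zeta>. norm (f (of_real (s n) * \<phi> (of_real r * \<zeta>))) powr p \<partial>circle_measure)
      \<le> 2 / (1 - norm (\<phi> 0)) * K" for n
  proof -
    define H where "H = herglotz (\<lambda>\<zeta>. norm (f (of_real (s n) * \<zeta>)) powr p)"
    have H: "H holomorphic_on ball 0 1"
      unfolding H_def by (intro herglotz_holomorphic continuous_on_dilate_powr f s p)
    have "(\<integral>\<zeta>. norm (f (of_real (s n) * \<phi> (of_real r * \<zeta>))) powr p \<partial>circle_measure)
        \<le> (\<integral>\<zeta>. Re (H (\<phi> (of_real r * \<zeta>))) \<partial>circle_measure)"
    proof (rule integral_mono)
      show "integrable circle_measure (\<lambda>\<zeta>. Re (H (\<phi> (of_real r * \<zeta>))))"
        using mean_value_self_map_Re(2)[OF H \<phi> r] by (rule integrable_Re)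
      fix \<zeta> assume "\<zeta> \<in> space circle_measure"
      then show "norm (f (of_real (s n) * \<phi> (of_real r * \<zeta>))) powr p \<le> Re (H (\<phi> (of_real r * \<zeta>)))"
        unfolding H_def
        by (intro dilate_norm_powr_le_herglotz f s p self_map_less[OF \<phi>] norm_scale_less r) auto
    qed (intro integrable_circle cont)
    also have "\<dots> = Re (H (\<phi> 0))"
      by (rule mean_value_self_map_Re[OF H \<phi> r])
    also have "\<dots> \<le> 2 / (1 - norm (\<phi> 0)) * hardy_mean p f (s n)"
      unfolding hardy_mean_def H_def
      by (rule Re_herglotz_le) (use f s p \<phi>0 in \<open>auto intro!: continuous_on_dilate_powr\<close>)
    also have "\<dots> \<le> 2 / (1 - norm (\<phi> 0)) * K"
      using K s \<phi>0 unfolding hardy_le_def by (intro mult_left_mono) auto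
    finally show ?thesis .
  qed
  moreover have "(\<lambda>n. \<integral>\<zeta>. norm (f (of_real (s n) * \<phi> (of_real r * \<zeta>))) powr p \<partial>circle_measure)
      \<longlonglongrightarrow> hardy_mean p (\<lambda>z. f (\<phi> z)) r"
    unfolding hardy_mean_def
  proof (rule circle_integral_tendsto[where B="B powr p"])
    show "continuous_on (sphere 0 1) (\<lambda>\<zeta>. norm (f (\<phi> (of_real r * \<zeta>))) powr p)"
      using continuous_on_dilate_powr[OF holomorphic_on_compose_self_map[OF f \<phi>] r p] .
  next
    fix n and \<zeta> :: complex assume "norm \<zeta> = 1"
    then show "norm (norm (f (of_real (s n) * \<phi> (of_real r * \<zeta>))) powr p) \<le> B powr p"
      using B[OF \<rho>(2), of \<zeta> n] p by (auto intro!: powr_mono2)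
  qed (use cont lim[OF \<rho>(2)] p in \<open>auto intro!: powr_norm_tendsto\<close>)
  ultimately show "hardy_mean p (\<lambda>z. f (\<phi> z)) r \<le> 2 / (1 - norm (\<phi> 0)) * K"
    by (intro LIMSEQ_le_const2) auto
qed

section \<open>Factorization through a function with values in the right half-plane\<close>

lemma integral_Re_herglotz_kernel:
  assumes "norm z < 1"
  shows "(\<integral>\<zeta>. Re (herglotz_kernel z \<zeta>) \<partial>circle_measure) = 1"
proof -
  have "of_real (\<integral>\<zeta>. Re (herglotz_kernel z \<zeta>) \<partial>circle_measure) = (1::complex)"
    using Poisson_formula[of "\<lambda>_. 1" z] assms by simp
  then show ?thesis by simp
qed

text \<open>The Cauchy-Schwarz inequality for the Poisson kernel, which has total mass 1.\<close>

lemma Re_herglotz_square_le: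
  assumes v: "continuous_on (sphere 0 1) v" and z: "norm z < 1"
  shows "(Re (herglotz v z))\<^sup>2 \<le> Re (herglotz (\<lambda>\<zeta>. (v \<zeta>)\<^sup>2) z)"
proof -
  define c where "c = Re (herglotz v z)"
  let ?K = "\<lambda>\<zeta>. Re (herglotz_kernel z \<zeta>)"
  have int: "integrable circle_measure (\<lambda>\<zeta>. ?K \<zeta> * (v \<zeta>)\<^sup>2)" "integrable circle_measure (\<lambda>\<zeta>. ?K \<zeta> * v \<zeta>)"
    "integrable circle_measure ?K"
    using v z by (auto intro!: integrable_circle continuous_intros)
  have "0 \<le> (\<integral>\<zeta>. ?K \<zeta> * (v \<zeta> - c)\<^sup>2 \<partial>circle_measure)"
    using Re_herglotz_kernel_bounds(1)[OF _ z] by (intro integral_nonneg_AE AE_I2) auto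
  also have "\<dots> = (\<integral>\<zeta>. ?K \<zeta> * (v \<zeta>)\<^sup>2 - (2 * c) * (?K \<zeta> * v \<zeta>) + c\<^sup>2 * ?K \<zeta> \<partial>circle_measure)"
    by (rule Bochner_Integration.integral_cong) (auto simp: power2_eq_square algebra_simps)
  also have "\<dots> = (\<integral>\<zeta>. ?K \<zeta> * (v \<zeta>)\<^sup>2 \<partial>circle_measure) - (2 * c) * (\<integral>\<zeta>. ?K \<zeta> * v \<zeta> \<partial>circle_measure) + c\<^sup>2 * (\<integral>\<zeta>. ?K \<zeta> \<partial>circle_measure)"
    using int by (subst Bochner_Integration.integral_add Bochner_Integration.integral_diff integral_mult_right_zero; simp)+
  also have "\<dots> = Re (herglotz (\<lambda>\<zeta>. (v \<zeta>)\<^sup>2) z) - c\<^sup>2"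
    using v z by (simp add: Re_herglotz continuous_intros integral_Re_herglotz_kernel c_def power2_eq_square)
  finally show ?thesis unfolding c_def by simp
qed

lemma norm_herglotz_le:
  assumes v: "continuous_on (sphere 0 1) v" "\<And>\<zeta>. norm \<zeta> = 1 \<Longrightarrow> 0 \<le> v \<zeta>" and z: "norm z < 1"
  shows "norm (herglotz v z) \<le> 2 / (1 - norm z) * (\<integral>\<zeta>. v \<zeta> \<partial>circle_measure)"
proof -
  have "norm (herglotz v z) \<le> (\<integral>\<zeta>. norm (herglotz_kernel z \<zeta> * of_real (v \<zeta>)) \<partial>circle_measure)"
    unfolding herglotz_def by (rule integral_norm_bound)
  also have "\<dots> \<le> (\<integral>\<zeta>. 2 / (1 - norm z) * v \<zeta> \<partial>circle_measure)"
  proof (rule integral_mono)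
    fix \<zeta> assume "\<zeta> \<in> space circle_measure"
    then have \<zeta>: "norm \<zeta> = 1" by simp
    have "norm (\<zeta> + z) \<le> 2" using norm_triangle_ineq[of \<zeta> z] \<zeta> z by simp
    moreover have "1 - norm z \<le> norm (\<zeta> - z)" using norm_triangle_ineq2[of \<zeta> z] \<zeta> by simp
    ultimately have "norm (herglotz_kernel z \<zeta>) \<le> 2 / (1 - norm z)"
      unfolding herglotz_kernel_def norm_divide using z by (intro frac_le) auto
    then show "norm (herglotz_kernel z \<zeta> * of_real (v \<zeta>)) \<le> 2 / (1 - norm z) * v \<zeta>"
      using v(2)[OF \<zeta>] z unfolding norm_mult by (intro mult_mono) auto
  qed (use v z in \<open>auto intro!: integrable_circle continuous_intros\<close>)
  finally show ?thesis by (subst (asm) integral_mult_right_zero)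
qed

text \<open>A dilate of \<open>f\<close> in the unit ball of \<open>H\<^sup>q\<close> is a bounded function \<open>m\<close> times a power of \<open>h = exp u\<close>, where
\<open>h\<close> takes values in the right half-plane and is bounded in \<open>H\<^sup>2\<close>. The function \<open>h\<close> is the Herglotz
integral of \<open>v = 1 + \<bar>f\<bar> powr (q / 2)\<close>: subharmonicity gives \<open>\<bar>f\<bar> \<le> \<bar>h\<bar> powr (2 / q)\<close>, hence \<open>\<bar>m\<bar> \<le> 1\<close>;
and \<open>v\<close> is square integrable, where the conjugate function is bounded by an elementary
argument. All powers of \<open>h\<close>, imaginary ones included, are available because the argument of \<open>h\<close> is
bounded, so the exponent \<open>2 / q\<close> can be traded for \<open>2 / p\<close>. The summand 1 in \<open>v\<close> yields
\<open>1 \<le> \<bar>h\<bar>\<close>, hence \<open>\<bar>m\<bar> \<le> \<bar>f\<bar>\<close>: if \<open>f\<close> is small on a compact set, so is \<open>m\<close>.\<close>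

lemma sector_factorization:
  assumes f: "f holomorphic_on ball 0 1" and q: "0 < q" and s: "0 < s" "s < 1"
    and le1: "hardy_mean q f s \<le> 1"
  obtains u m where "u holomorphic_on ball 0 1" "m holomorphic_on ball 0 1"
    and "\<And>z. norm z < 1 \<Longrightarrow> f (of_real s * z) = m z * exp (of_real (2 / q) * u z)"
    and "\<And>z. norm z < 1 \<Longrightarrow> norm (m z) \<le> 1"
    and "\<And>z. norm z < 1 \<Longrightarrow> norm (m z) \<le> norm (f (of_real s * z))"
    and "\<And>z. norm z < 1 \<Longrightarrow> \<bar>Im (u z)\<bar> < pi / 2"
    and "\<And>z. norm z < 1 \<Longrightarrow> norm (exp (u z)) \<le> 8 / (1 - norm z)"
    and "\<And>\<phi>. holomorphic_self_map \<phi> \<Longrightarrow> hardy_le 2 (\<lambda>z. exp (u (\<phi> z))) (80 / (1 - norm (\<phi> 0))\<^sup>2)"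
proof -
  define v0 where "v0 = (\<lambda>\<zeta>. norm (f (of_real s * \<zeta>)) powr (q / 2))"
  define v where "v = (\<lambda>\<zeta>. v0 \<zeta> + 1)"
  define h where "h = herglotz v"
  define H where "H = herglotz (\<lambda>\<zeta>. (v \<zeta>)\<^sup>2)"
  have v0: "continuous_on (sphere 0 1) v0" "0 \<le> v0 \<zeta>" for \<zeta>
    using continuous_on_dilate_powr[OF f s, of "q/2"] q by (auto simp: v0_def)
  have v: "continuous_on (sphere 0 1) v" "1 \<le> v \<zeta>" for \<zeta>
    using v0 by (auto simp: v_def intro!: continuous_intros)
  have v2: "continuous_on (sphere 0 1) (\<lambda>\<zeta>. (v \<zeta>)\<^sup>2)"
    using v by (intro continuous_intros)
  have hol: "h holomorphic_on ball 0 1" "H holomorphic_on ball 0 1"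
    unfolding h_def H_def by (intro herglotz_holomorphic v v2)+
  have int_v2: "(\<integral>\<zeta>. (v \<zeta>)\<^sup>2 \<partial>circle_measure) \<le> 4"
  proof -
    have "(\<integral>\<zeta>. (v \<zeta>)\<^sup>2 \<partial>circle_measure) \<le> (\<integral>\<zeta>. 2 * norm (f (of_real s * \<zeta>)) powr q + 2 \<partial>circle_measure)"
    proof (rule integral_mono)
      fix \<zeta> :: complex
      have "(v \<zeta>)\<^sup>2 \<le> 2 * (v0 \<zeta>)\<^sup>2 + 2"
        using zero_le_power2[of "v0 \<zeta> - 1"] unfolding v_def by (simp add: power2_eq_square algebra_simps)
      also have "(v0 \<zeta>)\<^sup>2 = norm (f (of_real s * \<zeta>)) powr q"
        by (simp add: v0_def power2_eq_square powr_add[symmetric])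
      finally show "(v \<zeta>)\<^sup>2 \<le> 2 * norm (f (of_real s * \<zeta>)) powr q + 2" by simp
    qed (auto intro!: integrable_circle v2 continuous_on_add continuous_on_mult_left continuous_on_dilate_powr[OF f s q])
    also have "\<dots> = (\<integral>\<zeta>. 2 * norm (f (of_real s * \<zeta>)) powr q \<partial>circle_measure) + (\<integral>\<zeta>. 2 \<partial>circle_measure)"
      by (intro Bochner_Integration.integral_add integrable_circle continuous_on_mult_left
          continuous_on_const continuous_on_dilate_powr[OF f s q])
    also have "(\<integral>\<zeta>. 2 * norm (f (of_real s * \<zeta>)) powr q \<partial>circle_measure) = 2 * hardy_mean q f s"
      unfolding hardy_mean_def by (rule integral_mult_right_zero)
    also have "(\<integral>\<zeta>. 2 \<partial>circle_measure) = (2::real)"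
    proof -
      have "measure circle_measure (sphere 0 1) *\<^sub>R (1::complex) = 1"
        using mean_value_circle[of "\<lambda>_. 1"] by simp
      then have "measure circle_measure (sphere 0 1) = 1" by (simp add: scaleR_conv_of_real)
      then show ?thesis by simp
    qed
    finally show ?thesis using le1 by linarith
  qed
  have int_v: "(\<integral>\<zeta>. v \<zeta> \<partial>circle_measure) \<le> 4"
  proof -
    have "v \<zeta> * 1 \<le> v \<zeta> * v \<zeta>" for \<zeta>
      using v(2)[of \<zeta>] by (intro mult_left_mono) auto
    then have "(\<integral>\<zeta>. v \<zeta> \<partial>circle_measure) \<le> (\<integral>\<zeta>. (v \<zeta>)\<^sup>2 \<partial>circle_measure)"
      using v v2 by (intro integral_mono integrable_circle) (auto simp: power2_eq_square)
    then show ?thesis using int_v2 by simp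
  qed
  have Reh: "norm (f (of_real s * z)) powr (q / 2) + 1 \<le> Re (h z)" if z: "norm z < 1" for z
  proof -
    have "Re (h z) = Re (herglotz v0 z) + (\<integral>\<zeta>. Re (herglotz_kernel z \<zeta>) \<partial>circle_measure)"
      unfolding h_def Re_herglotz[OF v(1) z] Re_herglotz[OF v0(1) z]
      unfolding v_def distrib_left mult_1_right
      using z v0 by (intro Bochner_Integration.integral_add integrable_circle continuous_intros)
    then show ?thesis
      using dilate_norm_powr_le_herglotz[OF f s _ z, of "q/2"] q z
      by (simp add: v0_def integral_Re_herglotz_kernel)
  qed
  have Reh1: "1 \<le> Re (h z)" if "norm z < 1" for z
    using Reh[OF that] powr_ge_zero[of "norm (f (of_real s * z))" "q/2"] by linarith
  have norm_h: "norm (h z) \<le> 8 / (1 - norm z)" if z: "norm z < 1" for z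
  proof -
    have "norm (h z) \<le> 2 / (1 - norm z) * (\<integral>\<zeta>. v \<zeta> \<partial>circle_measure)"
      unfolding h_def using v(2) by (intro norm_herglotz_le v z) (meson order_trans zero_le_one)
    also have "\<dots> \<le> 2 / (1 - norm z) * 4"
      using z int_v by (intro mult_left_mono) auto
    finally show ?thesis by simp
  qed
  define u where "u = (\<lambda>z. Ln (h z))"
  define m where "m = (\<lambda>z. f (of_real s * z) * exp (- (of_real (2 / q) * u z)))"
  have expu: "exp (u z) = h z" if "norm z < 1" for z
    using Reh1[OF that] by (cases "h z = 0") (auto simp: u_def)
  have hol_u: "u holomorphic_on ball 0 1"
    unfolding u_def
  proof (rule holomorphic_on_Ln'[OF _ hol(1)])
    fix z :: complex assume "z \<in> ball 0 1"
    then show "h z \<notin> \<real>\<^sub>\<le>\<^sub>0" using Reh1[of z] by (auto simp: complex_nonpos_Reals_iff)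
  qed
  have hol_m: "m holomorphic_on ball 0 1"
    unfolding m_def
    using holomorphic_on_subset[OF holomorphic_on_dilate[OF f s], of "ball 0 1"] hol_u
    by (auto intro!: holomorphic_intros)
  have norm_m: "norm (m z) = norm (f (of_real s * z)) / norm (h z) powr (2 / q)" if "norm z < 1" for z
  proof -
    have "norm (exp (of_real (2 / q) * u z)) = norm (h z) powr (2 / q)"
      using expu[OF that, symmetric] by (simp add: powr_def)
    then show ?thesis by (simp add: m_def exp_minus norm_mult norm_inverse divide_inverse)
  qed
  have norm_h_ge: "norm (f (of_real s * z)) \<le> norm (h z) powr (2 / q)" "1 \<le> norm (h z) powr (2 / q)"
    if z: "norm z < 1" for z
  proof -
    have *: "norm (f (of_real s * z)) powr (q / 2) + 1 \<le> norm (h z)"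
      using Reh[OF z] complex_Re_le_cmod[of "h z"] by linarith
    have "norm (f (of_real s * z)) = (norm (f (of_real s * z)) powr (q / 2)) powr (2 / q)"
      using q by (simp add: powr_powr)
    also have "\<dots> \<le> norm (h z) powr (2 / q)"
      using * q by (intro powr_mono2) auto
    finally show "norm (f (of_real s * z)) \<le> norm (h z) powr (2 / q)" .
    have "1 \<le> norm (h z)" using * powr_ge_zero[of "norm (f (of_real s * z))" "q/2"] by linarith
    then show "1 \<le> norm (h z) powr (2 / q)" using q by (intro ge_one_powr_ge_zero) auto
  qed
  have mean_h: "hardy_le 2 (\<lambda>z. exp (u (\<phi> z))) (80 / (1 - norm (\<phi> 0))\<^sup>2)" if \<phi>: "holomorphic_self_map \<phi>" for \<phi>
    unfolding hardy_le_def
  proof (intro allI impI)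
    fix r :: real assume r: "0 < r" "r < 1"
    have \<phi>0: "norm (\<phi> 0) < 1" using self_map_less[OF \<phi>] by simp
    have \<phi>r: "norm (\<phi> (of_real r * \<zeta>)) < 1" if "norm \<zeta> = 1" for \<zeta>
      using self_map_less[OF \<phi> norm_scale_less[OF r]] that by simp
    have hol2: "(\<lambda>z. (h z)\<^sup>2) holomorphic_on ball 0 1"
      by (intro holomorphic_intros hol)
    have int: "integrable circle_measure (\<lambda>\<zeta>. Re (H (\<phi> (of_real r * \<zeta>))))"
      "integrable circle_measure (\<lambda>\<zeta>. Re ((h (\<phi> (of_real r * \<zeta>)))\<^sup>2))"
      using mean_value_self_map_Re(2)[OF hol(2) \<phi> r] mean_value_self_map_Re(2)[OF hol2 \<phi> r]
      by (auto intro: integrable_Re)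
    have "hardy_mean 2 (\<lambda>z. exp (u (\<phi> z))) r
        \<le> (\<integral>\<zeta>. 2 * Re (H (\<phi> (of_real r * \<zeta>))) - Re ((h (\<phi> (of_real r * \<zeta>)))\<^sup>2) \<partial>circle_measure)"
      unfolding hardy_mean_def
    proof (rule integral_mono)
      show "integrable circle_measure (\<lambda>\<zeta>. norm (exp (u (\<phi> (of_real r * \<zeta>)))) powr 2)"
        by (intro integrable_circle
            continuous_on_dilate_powr[OF holomorphic_on_compose_self_map[OF holomorphic_on_exp'[OF hol_u] \<phi>] r]) auto
      fix \<zeta> assume "\<zeta> \<in> space circle_measure"
      then have \<zeta>: "norm \<zeta> = 1" by simp
      define w where "w = \<phi> (of_real r * \<zeta>)"
      have w: "norm w < 1" using \<phi>r[OF \<zeta>] by (simp add: w_def)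
      \<comment> \<open>The mean of the square of h \<circ> \<phi> is its value at 0, so the square of the imaginary part is controlled
        by that of the real part.\<close>
      have "norm (exp (u w)) powr 2 = (norm (h w))\<^sup>2"
        using expu[OF w] by (simp del: norm_exp_eq_Re)
      also have "\<dots> = 2 * (Re (h w))\<^sup>2 - Re ((h w)\<^sup>2)"
        by (simp add: cmod_power2 Re_power2)
      also have "(Re (h w))\<^sup>2 \<le> Re (H w)"
        unfolding h_def H_def by (rule Re_herglotz_square_le[OF v(1) w])
      finally show "norm (exp (u (\<phi> (of_real r * \<zeta>)))) powr 2
          \<le> 2 * Re (H (\<phi> (of_real r * \<zeta>))) - Re ((h (\<phi> (of_real r * \<zeta>)))\<^sup>2)"
        by (simp add: w_def)
    qed (use int in auto)
    also have "\<dots> = 2 * Re (H (\<phi> 0)) - Re ((h (\<phi> 0))\<^sup>2)"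
      using int mean_value_self_map_Re(1)[OF hol(2) \<phi> r] mean_value_self_map_Re(1)[OF hol2 \<phi> r]
      by (subst Bochner_Integration.integral_diff) auto
    finally have sum: "hardy_mean 2 (\<lambda>z. exp (u (\<phi> z))) r \<le> 2 * Re (H (\<phi> 0)) - Re ((h (\<phi> 0))\<^sup>2)" .
    have sq: "- Re ((h (\<phi> 0))\<^sup>2) \<le> (8 / (1 - norm (\<phi> 0)))\<^sup>2"
      using abs_Re_le_cmod[of "(h (\<phi> 0))\<^sup>2"] norm_h[OF \<phi>0] power_mono[OF norm_h[OF \<phi>0], of 2]
      by (simp add: norm_power)
    have "Re (H (\<phi> 0)) \<le> 2 / (1 - norm (\<phi> 0)) * (\<integral>\<zeta>. (v \<zeta>)\<^sup>2 \<partial>circle_measure)"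
      unfolding H_def by (rule Re_herglotz_le[OF v2 _ \<phi>0]) auto
    also have "\<dots> \<le> 2 / (1 - norm (\<phi> 0)) * 4"
      using \<phi>0 int_v2 by (intro mult_left_mono) auto
    also have "2 / (1 - norm (\<phi> 0)) * 4 \<le> 8 / (1 - norm (\<phi> 0))\<^sup>2"
    proof -
      have "(1 - norm (\<phi> 0))\<^sup>2 \<le> 1 - norm (\<phi> 0)"
        using \<phi>0 by (simp add: power2_eq_square mult_left_le)
      then show ?thesis using \<phi>0 by (auto intro!: divide_left_mono)
    qed
    finally have "Re (H (\<phi> 0)) \<le> 8 / (1 - norm (\<phi> 0))\<^sup>2" .
    moreover have "(8 / (1 - norm (\<phi> 0)))\<^sup>2 = 64 / (1 - norm (\<phi> 0))\<^sup>2"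
      "80 / (1 - norm (\<phi> 0))\<^sup>2 = 2 * (8 / (1 - norm (\<phi> 0))\<^sup>2) + 64 / (1 - norm (\<phi> 0))\<^sup>2"
      by (simp_all add: power_divide)
    ultimately show "hardy_mean 2 (\<lambda>z. exp (u (\<phi> z))) r \<le> 80 / (1 - norm (\<phi> 0))\<^sup>2"
      using sum sq by linarith
  qed
  show ?thesis
  proof (rule that[OF hol_u hol_m])
    fix z :: complex assume z: "norm z < 1"
    show "f (of_real s * z) = m z * exp (of_real (2 / q) * u z)"
      by (simp add: m_def exp_minus field_simps)
    show "norm (m z) \<le> 1"
      using norm_m[OF z] norm_h_ge[OF z] by (simp add: divide_le_eq)
    have "norm (f (of_real s * z)) / norm (h z) powr (2 / q) \<le> norm (f (of_real s * z)) / 1"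
      using norm_h_ge(2)[OF z] by (intro divide_left_mono) auto
    then show "norm (m z) \<le> norm (f (of_real s * z))" using norm_m[OF z] by simp
    show "\<bar>Im (u z)\<bar> < pi / 2"
      unfolding u_def using Reh1[OF z] by (intro Re_Ln_pos_lt_imp) auto
    show "norm (exp (u z)) \<le> 8 / (1 - norm z)"
      using norm_h[OF z] expu[OF z] by (simp del: norm_exp_eq_Re)
  qed (rule mean_h)
qed


section \<open>A pointwise inequality between exponents\<close>

text \<open>With \<open>X = x * exp (N * a)\<close> and \<open>Y = y * exp (N * b)\<close>, suppose that \<open>X\<close> is not small. If \<open>X \<approx> Y\<close> and
\<open>X * exp (\<i> * \<tau> * a) \<approx> Y * exp (\<i> * \<tau> * b)\<close>, then \<open>exp (\<i> * \<tau> * (a - b)) \<approx> 1\<close>. Both \<open>a\<close> and \<open>b\<close> lie in a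
bounded set that is known in advance, so for a small enough \<open>\<tau>\<close> the logarithm is unambiguous and
\<open>a \<approx> b\<close>. Then the products stay close for every other exponent \<open>Q\<close> in place of \<open>N\<close>. The second test,
with an imaginary power, rules out that \<open>N * (a - b)\<close> is near a nonzero period of \<open>exp\<close>, and
that \<open>x\<close> and \<open>y\<close> compensate for different values of the exponentials.\<close>

lemma two_test_functions_normalized:
  fixes N Q \<kappa> :: real
  assumes N: "0 < N" and Q: "0 < Q" and \<kappa>: "0 < \<kappa>"
  shows "\<exists>\<tau>>0. \<exists>c>0. \<forall>a b x y :: complex. \<bar>Im a\<bar> < pi / 2 \<longrightarrow> \<bar>Im b\<bar> < pi / 2 \<longrightarrow> Re a \<le> 0 \<longrightarrow> Re b \<le> 0 \<longrightarrow>
      norm x \<le> 1 \<longrightarrow> norm y \<le> 1 \<longrightarrow> \<kappa> \<le> norm (x * exp (of_real Q * a)) \<longrightarrow>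
      norm (x * exp (of_real N * a) - y * exp (of_real N * b)) < c \<longrightarrow>
      norm (x * exp ((of_real N + \<i> * of_real \<tau>) * a) - y * exp ((of_real N + \<i> * of_real \<tau>) * b)) < c \<longrightarrow>
      norm (x * exp (of_real Q * a) - y * exp (of_real Q * b)) < 2 * \<kappa>"
proof -
  \<comment> \<open>The real parts of a and b will turn out to lie above -A and -A', so the difference a - b has real part
    at most D in modulus; c1 is the lower bound for the modulus of x * exp (N * a).\<close>
  define A where "A = - ln \<kappa> / Q"
  define c1 where "c1 = \<kappa> * exp (- (N * A))"
  define A' where "A' = - ln (c1 / 2) / N"
  define D where "D = \<bar>A\<bar> + \<bar>A'\<bar>"
  define \<tau> where "\<tau> = 1 / (D + pi)"
  have c1: "0 < c1" using \<kappa> by (simp add: c1_def)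
  have Dpi: "0 < D + pi" using pi_gt_zero by (simp add: D_def add_nonneg_pos)
  have \<tau>: "0 < \<tau>" using Dpi by (simp add: \<tau>_def)
  let ?X = "\<lambda>x a. x * exp (of_real N * a)"
  let ?Z = "\<lambda>x a. x * exp ((of_real N + \<i> * of_real \<tau>) * a)"
  let ?F = "\<lambda>x a. x * exp (of_real Q * a)"
  define P where "P = (\<lambda>a b x y c. \<bar>Im a\<bar> < pi / 2 \<and> \<bar>Im b\<bar> < pi / 2 \<and> Re a \<le> 0 \<and> Re b \<le> 0 \<and>
      norm x \<le> 1 \<and> norm y \<le> 1 \<and> \<kappa> \<le> norm (?F x a) \<and>
      norm (?X x a - ?X y b) < c \<and> norm (?Z x a - ?Z y b) < c \<and> 2 * \<kappa> \<le> norm (?F x a - ?F y b))"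
  have "\<exists>c>0. \<forall>a b x y. \<not> P a b x y c"
  proof (rule ccontr)
    assume contra: "\<not> ?thesis"
    define e where "e = (\<lambda>n. min (c1 / 2) (inverse (real (Suc n))))"
    have e: "0 < e n" "e n \<le> c1 / 2" for n using c1 by (auto simp: e_def)
    have "(\<lambda>n. min (c1 / 2) (inverse (real (Suc n)))) \<longlonglongrightarrow> min (c1 / 2) 0"
      by (intro tendsto_min tendsto_const LIMSEQ_inverse_real_of_nat)
    then have e_lim: "e \<longlonglongrightarrow> 0" using c1 by (simp add: e_def min_def)
    \<comment> \<open>A sequence of counterexamples with tests tending to 0; along it the difference of a and b tends to 0.\<close>
    have "\<forall>n. \<exists>a b x y. P a b x y (e n)" using contra e by blast
    then obtain a b x y where P: "\<And>n. P (a n) (b n) (x n) (y n) (e n)" by metis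
    define d where "d = (\<lambda>n. a n - b n)"
    have ab: "\<bar>Im (a n)\<bar> < pi / 2" "\<bar>Im (b n)\<bar> < pi / 2" "Re (a n) \<le> 0" "Re (b n) \<le> 0"
      and xy: "norm (x n) \<le> 1" "norm (y n) \<le> 1"
      and F: "\<kappa> \<le> norm (?F (x n) (a n))"
      and XX: "norm (?X (x n) (a n) - ?X (y n) (b n)) < e n"
      and ZZ: "norm (?Z (x n) (a n) - ?Z (y n) (b n)) < e n"
      and FF: "2 * \<kappa> \<le> norm (?F (x n) (a n) - ?F (y n) (b n))" for n
      using P[of n] unfolding P_def by auto
    have expQ: "exp (Q * Re (a n)) \<le> 1" for n using ab[of n] Q by (simp add: mult_nonneg_nonpos)
    have x_ge: "\<kappa> \<le> norm (x n)" for n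
      using F[of n] mult_left_le[OF expQ[of n], of "norm (x n)"] by (simp add: norm_mult)
    have a_ge: "- A \<le> Re (a n)" for n
    proof -
      have "\<kappa> \<le> exp (Q * Re (a n))"
        using order_trans[OF F[of n, unfolded norm_mult] mult_right_mono[OF xy(1)[of n] norm_ge_zero]] by simp
      then have "ln \<kappa> \<le> Q * Re (a n)" using ln_le_cancel_iff[of \<kappa> "exp (Q * Re (a n))"] \<kappa> by simp
      then show ?thesis using Q by (simp add: A_def field_simps)
    qed
    have X_ge: "c1 \<le> norm (?X (x n) (a n))" for n
    proof -
      have "exp (- (N * A)) \<le> exp (N * Re (a n))" using mult_left_mono[OF a_ge[of n], of N] N by simp
      then show ?thesis unfolding c1_def norm_mult using x_ge[of n] \<kappa> by (intro mult_mono) auto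
    qed
    have b_ge: "- A' \<le> Re (b n)" for n
    proof -
      have "norm (?X (x n) (a n)) - norm (?X (y n) (b n)) \<le> c1 / 2"
        using norm_triangle_ineq2[of "?X (x n) (a n)" "?X (y n) (b n)"] XX[of n] e(2)[of n] by linarith
      then have "c1 / 2 \<le> norm (?X (y n) (b n))" using X_ge[of n] by linarith
      also have "\<dots> \<le> exp (N * Re (b n))"
        using mult_right_mono[OF xy(2)[of n], of "exp (N * Re (b n))"] by (simp add: norm_mult)
      finally have "ln (c1 / 2) \<le> N * Re (b n)" using ln_le_cancel_iff[of "c1 / 2" "exp (N * Re (b n))"] c1 by (simp del: ln_div)
      then show ?thesis using N by (simp add: A'_def field_simps)
    qed
    have Re_d: "\<bar>Re (d n)\<bar> \<le> D" for n
      using a_ge[of n] b_ge[of n] ab[of n] by (simp add: d_def D_def)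
    have expb: "norm (exp (\<i> * of_real \<tau> * b n)) \<le> exp (\<tau> * (pi / 2))"
      "exp (- (\<tau> * (pi / 2))) \<le> norm (exp (\<i> * of_real \<tau> * b n))" for n
    proof -
      have "\<bar>\<tau> * Im (b n)\<bar> \<le> \<tau> * (pi / 2)"
        using ab(2)[of n] \<tau> by (simp add: abs_mult)
      then show "norm (exp (\<i> * of_real \<tau> * b n)) \<le> exp (\<tau> * (pi / 2))"
        "exp (- (\<tau> * (pi / 2))) \<le> norm (exp (\<i> * of_real \<tau> * b n))" by auto
    qed
    \<comment> \<open>Subtracting the first test, multiplied by the factor of b, from the second isolates the difference of
      the two imaginary powers.\<close>
    define M where "M = (1 + exp (\<tau> * (pi / 2))) * exp (\<tau> * (pi / 2)) / c1"
    have bd: "norm (exp (\<i> * of_real \<tau> * d n) - 1) \<le> M * e n" for n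
    proof -
      let ?ea = "exp (\<i> * of_real \<tau> * a n)" and ?eb = "exp (\<i> * of_real \<tau> * b n)"
      have "?X (x n) (a n) * (?ea - ?eb) =
          (?Z (x n) (a n) - ?Z (y n) (b n)) - (?X (x n) (a n) - ?X (y n) (b n)) * ?eb"
        by (simp add: algebra_simps exp_add)
      then have "norm (?X (x n) (a n)) * norm (?ea - ?eb)
          \<le> norm (?Z (x n) (a n) - ?Z (y n) (b n)) + norm (?X (x n) (a n) - ?X (y n) (b n)) * norm ?eb"
        by (metis norm_mult norm_triangle_ineq4)
      also have "\<dots> \<le> e n + e n * exp (\<tau> * (pi / 2))"
        using XX[of n] ZZ[of n] expb(1)[of n] e(1)[of n] by (intro add_mono mult_mono) auto
      finally have "c1 * norm (?ea - ?eb) \<le> e n * (1 + exp (\<tau> * (pi / 2)))"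
        using mult_right_mono[OF X_ge[of n], of "norm (?ea - ?eb)"] by (simp add: algebra_simps)
      then have 1: "norm (?ea - ?eb) \<le> e n * (1 + exp (\<tau> * (pi / 2))) / c1"
        using c1 by (simp add: field_simps)
      have "?ea = exp (\<i> * of_real \<tau> * d n) * ?eb"
        by (simp add: d_def algebra_simps flip: exp_add)
      then have "norm (?ea - ?eb) = norm (exp (\<i> * of_real \<tau> * d n) - 1) * norm ?eb"
        by (metis left_diff_distrib mult_1 norm_mult)
      then have "norm (exp (\<i> * of_real \<tau> * d n) - 1) * exp (- (\<tau> * (pi / 2))) \<le> norm (?ea - ?eb)"
        using mult_left_mono[OF expb(2)[of n], of "norm (exp (\<i> * of_real \<tau> * d n) - 1)"] by simp
      with 1 have "norm (exp (\<i> * of_real \<tau> * d n) - 1) * exp (- (\<tau> * (pi / 2)))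
          \<le> e n * (1 + exp (\<tau> * (pi / 2))) / c1" by linarith
      then show ?thesis using c1 by (simp add: M_def exp_minus field_simps)
    qed
    have "(\<lambda>n. exp (\<i> * of_real \<tau> * d n) - 1) \<longlonglongrightarrow> 0"
      by (rule Lim_null_comparison[OF always_eventually tendsto_mult_right_zero[OF e_lim]]) (use bd in blast)
    then have "(\<lambda>n. exp (\<i> * of_real \<tau> * d n)) \<longlonglongrightarrow> 1" by (simp add: LIM_zero_iff)
    then have "(\<lambda>n. Ln (exp (\<i> * of_real \<tau> * d n))) \<longlonglongrightarrow> Ln 1"
      by (intro tendsto_Ln) auto
    moreover have "Ln (exp (\<i> * of_real \<tau> * d n)) = \<i> * of_real \<tau> * d n" for n
    proof (rule Ln_exp)
      have "\<bar>\<tau> * Re (d n)\<bar> \<le> 1"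
      proof -
        have "\<bar>Re (d n)\<bar> \<le> D + pi" using Re_d[of n] pi_gt_zero by linarith
        then show ?thesis using Dpi by (simp add: \<tau>_def abs_mult field_simps)
      qed
      then have "\<bar>\<tau> * Re (d n)\<bar> < pi" using pi_gt3 by linarith
      then show "- pi < Im (\<i> * of_real \<tau> * d n)" "Im (\<i> * of_real \<tau> * d n) \<le> pi" by auto
    qed
    ultimately have "(\<lambda>n. (\<i> * of_real \<tau> * d n) / (\<i> * of_real \<tau>)) \<longlonglongrightarrow> 0 / (\<i> * of_real \<tau>)"
      using \<tau> by (intro tendsto_divide tendsto_const) auto
    then have d_lim: "d \<longlonglongrightarrow> 0" using \<tau> by simp
    \<comment> \<open>Passing from the exponent N to Q costs only the factor exp ((Q - N) * a), which is bounded.\<close>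
    have L: "norm (?F (x n) (a n) - ?F (y n) (b n))
        \<le> exp (\<bar>Q - N\<bar> * D) * (e n + norm (1 - exp (- (of_real (Q - N) * d n))))" for n
    proof -
      have "?F (x n) (a n) - ?F (y n) (b n) = exp (of_real (Q - N) * a n) *
          ((?X (x n) (a n) - ?X (y n) (b n)) + ?X (y n) (b n) * (1 - exp (- (of_real (Q - N) * d n))))"
      proof -
        have 1: "exp (of_real (Q - N) * a n) * ?X (x n) (a n) = ?F (x n) (a n)"
          by (simp add: algebra_simps flip: exp_add)
        have 2: "exp (of_real (Q - N) * a n) * (?X (y n) (b n) * exp (- (of_real (Q - N) * d n))) = ?F (y n) (b n)"
          by (simp add: d_def algebra_simps flip: exp_add)
        have "E * ((A - B) + B * (1 - G)) = E * A - E * (B * G)" for E A B G :: complex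
          by (simp add: algebra_simps)
        then show ?thesis by (simp only: 1 2)
      qed
      then have "norm (?F (x n) (a n) - ?F (y n) (b n)) = norm (exp (of_real (Q - N) * a n)) *
          norm ((?X (x n) (a n) - ?X (y n) (b n)) + ?X (y n) (b n) * (1 - exp (- (of_real (Q - N) * d n))))"
        by (metis norm_mult)
      also have "\<dots> \<le> exp (\<bar>Q - N\<bar> * D) * (e n + norm (1 - exp (- (of_real (Q - N) * d n))))"
      proof (intro mult_mono)
        have "\<bar>Re (a n)\<bar> \<le> D" using a_ge[of n] ab(3)[of n] by (simp add: D_def)
        then have "\<bar>(Q - N) * Re (a n)\<bar> \<le> \<bar>Q - N\<bar> * D"
          unfolding abs_mult by (intro mult_left_mono) auto
        then show "norm (exp (of_real (Q - N) * a n)) \<le> exp (\<bar>Q - N\<bar> * D)" by auto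
        have "exp (N * Re (b n)) \<le> 1" using ab(4)[of n] N by (simp add: mult_nonneg_nonpos)
        then have "norm (?X (y n) (b n)) \<le> 1"
          using xy(2)[of n] by (auto simp: norm_mult intro!: mult_le_one)
        then have "norm (?X (y n) (b n) * (1 - exp (- (of_real (Q - N) * d n)))) \<le> norm (1 - exp (- (of_real (Q - N) * d n)))"
          using mult_right_mono[of "norm (?X (y n) (b n))" 1 "norm (1 - exp (- (of_real (Q - N) * d n)))"]
          by (simp add: norm_mult)
        then show "norm ((?X (x n) (a n) - ?X (y n) (b n)) + ?X (y n) (b n) * (1 - exp (- (of_real (Q - N) * d n))))
            \<le> e n + norm (1 - exp (- (of_real (Q - N) * d n)))"
          using XX[of n] by (intro norm_triangle_le) linarith
      qed auto
      finally show ?thesis .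
    qed
    have "(\<lambda>n. exp (\<bar>Q - N\<bar> * D) * (e n + norm (1 - exp (- (of_real (Q - N) * d n)))))
        \<longlonglongrightarrow> exp (\<bar>Q - N\<bar> * D) * (0 + norm (1 - exp (- (of_real (Q - N) * (0::complex)))))"
      by (intro tendsto_intros e_lim d_lim)
    then have "(\<lambda>n. exp (\<bar>Q - N\<bar> * D) * (e n + norm (1 - exp (- (of_real (Q - N) * d n))))) \<longlonglongrightarrow> 0" by simp
    from LIMSEQ_le_const[OF this, of "2 * \<kappa>"] have "2 * \<kappa> \<le> 0"
      using order_trans[OF FF L] by blast
    then show False using \<kappa> by simp
  qed
  then obtain c where c: "0 < c" "\<And>a b x y. \<not> P a b x y c" by blast
  show ?thesis
  proof (rule exI[of _ \<tau>], intro conjI \<tau> exI[of _ c] c allI impI)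
    fix a b x y :: complex
    assume H: "\<bar>Im a\<bar> < pi / 2" "\<bar>Im b\<bar> < pi / 2" "Re a \<le> 0" "Re b \<le> 0" "norm x \<le> 1" "norm y \<le> 1"
      "\<kappa> \<le> norm (?F x a)" "norm (?X x a - ?X y b) < c" "norm (?Z x a - ?Z y b) < c"
    show "norm (?F x a - ?F y b) < 2 * \<kappa>"
      using c(2)[of a b x y] H unfolding P_def not_le[symmetric] by blast
  qed
qed

text \<open>The general case follows from the normalized one by homogeneity: adding the same real number to
\<open>a\<close> and \<open>b\<close> multiplies every term by the same factor, because \<open>(2 / p) * p = (2 / q) * q = 2\<close>. Either
the left side is below the \<open>\<epsilon>\<close>-term, or one of the tests is bounded below.\<close>

lemma two_test_functions:
  fixes p q \<epsilon> :: real
  assumes p: "0 < p" and q: "0 < q" and \<epsilon>: "0 < \<epsilon>"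
  obtains \<tau> C where "0 < \<tau>" "0 < C"
    "\<And>a b x y :: complex. \<bar>Im a\<bar> < pi / 2 \<Longrightarrow> \<bar>Im b\<bar> < pi / 2 \<Longrightarrow> norm x \<le> 1 \<Longrightarrow> norm y \<le> 1 \<Longrightarrow>
      norm (x * exp (of_real (2 / q) * a) - y * exp (of_real (2 / q) * b)) powr q
      \<le> \<epsilon> * (norm (exp a) powr 2 + norm (exp b) powr 2)
        + C * (norm (x * exp (of_real (2 / p) * a) - y * exp (of_real (2 / p) * b)) powr p
          + norm (x * exp ((of_real (2 / p) + \<i> * of_real \<tau>) * a)
              - y * exp ((of_real (2 / p) + \<i> * of_real \<tau>) * b)) powr p)"
proof -
  define \<kappa> where "\<kappa> = \<epsilon> powr (1 / q) / 2"
  have \<kappa>: "0 < \<kappa>" using \<epsilon> by (simp add: \<kappa>_def)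
  obtain \<tau> c where \<tau>: "0 < \<tau>" and c: "0 < c"
    and key: "\<And>a b x y :: complex. \<bar>Im a\<bar> < pi / 2 \<Longrightarrow> \<bar>Im b\<bar> < pi / 2 \<Longrightarrow> Re a \<le> 0 \<Longrightarrow> Re b \<le> 0 \<Longrightarrow>
      norm x \<le> 1 \<Longrightarrow> norm y \<le> 1 \<Longrightarrow> \<kappa> \<le> norm (x * exp (of_real (2 / q) * a)) \<Longrightarrow>
      norm (x * exp (of_real (2 / p) * a) - y * exp (of_real (2 / p) * b)) < c \<Longrightarrow>
      norm (x * exp ((of_real (2 / p) + \<i> * of_real \<tau>) * a) - y * exp ((of_real (2 / p) + \<i> * of_real \<tau>) * b)) < c \<Longrightarrow>
      norm (x * exp (of_real (2 / q) * a) - y * exp (of_real (2 / q) * b)) < 2 * \<kappa>"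
    using two_test_functions_normalized[of "2 / p" "2 / q" \<kappa>] p q \<kappa> by (metis divide_pos_pos zero_less_numeral)
  define C where "C = 2 powr q / c powr p"
  have C: "0 < C" using c by (simp add: C_def)
  show ?thesis
  proof (rule that[OF \<tau> C])
    fix a b x y :: complex
    assume ab: "\<bar>Im a\<bar> < pi / 2" "\<bar>Im b\<bar> < pi / 2" and xy: "norm x \<le> 1" "norm y \<le> 1"
    define D where "D = (\<lambda>w a b. norm (x * exp (w * a) - y * exp (w * b)))"
    \<comment> \<open>Subtracting M makes the larger of the two moduli equal to 1.\<close>
    define M where "M = max (Re a) (Re b)"
    define a' b' where "a' = a - of_real M" "b' = b - of_real M"
    have scale: "D w a b = exp (Re w * M) * D w a' b'" for w
    proof -
      have "x * exp (w * a) - y * exp (w * b) = exp (w * of_real M) * (x * exp (w * a') - y * exp (w * b'))"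
        by (simp add: a'_b'_def algebra_simps flip: exp_add)
      then show ?thesis by (simp add: D_def norm_mult)
    qed
    have ab': "\<bar>Im a'\<bar> < pi / 2" "\<bar>Im b'\<bar> < pi / 2" "Re a' \<le> 0" "Re b' \<le> 0"
      using ab by (auto simp: a'_b'_def M_def)
    have R2: "exp (2 * M) \<le> norm (exp a) powr 2 + norm (exp b) powr 2"
      by (auto simp: M_def max_def powr_def add_nonneg_nonneg)
    let ?N = "complex_of_real (2 / p)" and ?Q = "complex_of_real (2 / q)"
    let ?W = "?N + \<i> * of_real \<tau>"
    have Lq: "D ?Q a b powr q = exp (2 * M) * D ?Q a' b' powr q"
      unfolding scale[of ?Q] using q by (simp add: powr_mult exp_powr_real)
    have Ep: "D ?N a b powr p = exp (2 * M) * D ?N a' b' powr p" "D ?W a b powr p = exp (2 * M) * D ?W a' b' powr p"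
      unfolding scale[of ?N] scale[of ?W] using p by (simp_all add: powr_mult exp_powr_real)
    have exp_le: "norm (exp (?Q * a')) \<le> 1" "norm (exp (?Q * b')) \<le> 1"
      using ab' q by (auto simp: mult_nonneg_nonpos divide_nonpos_pos)
    have "D ?Q a' b' powr q \<le> \<epsilon> + C * (D ?N a' b' powr p + D ?W a' b' powr p)"
    proof (cases "D ?Q a' b' < 2 * \<kappa>")
      case True
      have "D ?Q a' b' powr q \<le> (2 * \<kappa>) powr q" using True q by (intro powr_mono2) (auto simp: D_def)
      also have "\<dots> = \<epsilon>" using \<epsilon> q by (simp add: \<kappa>_def powr_powr)
      finally show ?thesis using C by (smt (verit) mult_nonneg_nonneg powr_ge_zero)
    next
      case False
      have "2 * \<kappa> \<le> norm (x * exp (?Q * a')) + norm (y * exp (?Q * b'))"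
        using False norm_triangle_ineq4[of "x * exp (?Q * a')" "y * exp (?Q * b')"] by (simp add: D_def)
      then consider "\<kappa> \<le> norm (x * exp (?Q * a'))" | "\<kappa> \<le> norm (y * exp (?Q * b'))" by linarith
      then have "c \<le> D ?N a' b' \<or> c \<le> D ?W a' b'"
      proof cases
        case 1
        then show ?thesis using key[of a' b' x y] ab' xy False by (force simp: D_def)
      next
        case 2
        then show ?thesis using key[of b' a' y x] ab' xy False unfolding D_def norm_minus_commute[of "x * _"]
          by force
      qed
      then have "c powr p \<le> D ?N a' b' powr p + D ?W a' b' powr p"
      proof
        assume "c \<le> D ?N a' b'"
        then have "c powr p \<le> D ?N a' b' powr p" using c p by (intro powr_mono2) auto
        then show ?thesis by (simp add: add_increasing2)
      next
        assume "c \<le> D ?W a' b'"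
        then have "c powr p \<le> D ?W a' b' powr p" using c p by (intro powr_mono2) auto
        then show ?thesis by (simp add: add_increasing)
      qed
      then have "2 powr q \<le> C * (D ?N a' b' powr p + D ?W a' b' powr p)"
        using mult_left_mono[of "c powr p" "D ?N a' b' powr p + D ?W a' b' powr p" "2 powr q / c powr p"] c
        by (simp add: C_def)
      moreover have "D ?Q a' b' \<le> 2"
      proof -
        have "norm (x * exp (?Q * a')) \<le> 1" "norm (y * exp (?Q * b')) \<le> 1"
          unfolding norm_mult using xy exp_le by (auto intro!: mult_le_one)
        then show ?thesis
          using norm_triangle_ineq4[of "x * exp (?Q * a')" "y * exp (?Q * b')"] by (simp add: D_def)
      qed
      then have "D ?Q a' b' powr q \<le> 2 powr q" using q by (intro powr_mono2) (auto simp: D_def)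
      ultimately show ?thesis using \<epsilon> by linarith
    qed
    then have "exp (2 * M) * D ?Q a' b' powr q \<le> exp (2 * M) * (\<epsilon> + C * (D ?N a' b' powr p + D ?W a' b' powr p))"
      by (intro mult_left_mono) auto
    also have "\<dots> = \<epsilon> * exp (2 * M) + C * (D ?N a b powr p + D ?W a b powr p)"
      unfolding Ep by (simp add: algebra_simps)
    also have "\<epsilon> * exp (2 * M) \<le> \<epsilon> * (norm (exp a) powr 2 + norm (exp b) powr 2)"
      using R2 \<epsilon> by (intro mult_left_mono) auto
    finally show "norm (x * exp (?Q * a) - y * exp (?Q * b)) powr q
      \<le> \<epsilon> * (norm (exp a) powr 2 + norm (exp b) powr 2)
        + C * (norm (x * exp (?N * a) - y * exp (?N * b)) powr p + norm (x * exp (?W * a) - y * exp (?W * b)) powr p)"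
      unfolding Lq[symmetric] by (simp add: D_def)
  qed
qed

section \<open>Independence of the exponent\<close>

lemma hardy_mean_cmult:
  "hardy_mean p (\<lambda>z. c * f z) r = norm c powr p * hardy_mean p f r"
  unfolding hardy_mean_def by (subst integral_mult_right_zero[symmetric]) (simp add: norm_mult powr_mult)

lemma hardy_mean_cong:
  assumes "\<And>z. norm z < 1 \<Longrightarrow> f z = g z" "0 < r" "r < 1"
  shows "hardy_mean p f r = hardy_mean p g r"
  unfolding hardy_mean_def
  by (rule Bochner_Integration.integral_cong) (use assms norm_scale_less[OF assms(2,3)] in auto)

lemma hardy_le_cong:
  assumes "\<And>z. norm z < 1 \<Longrightarrow> f z = g z"
  shows "hardy_le p f K \<longleftrightarrow> hardy_le p g K"
  unfolding hardy_le_def using hardy_mean_cong[OF assms] by auto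

lemma hardy_le_mono: "hardy_le p f K \<Longrightarrow> K \<le> L \<Longrightarrow> hardy_le p f L"
  unfolding hardy_le_def by (meson order_trans)

lemma hardy_le_pointwise:
  assumes f: "f holomorphic_on ball 0 1" and g: "g holomorphic_on ball 0 1"
    and h: "h holomorphic_on ball 0 1" and pos: "0 < p" "0 < q" "0 < t"
    and pw: "\<And>z. norm z < 1 \<Longrightarrow> norm (h z) powr p \<le> A * norm (f z) powr q + B * norm (g z) powr t"
    and A: "0 \<le> A" "hardy_le q f K" and B: "0 \<le> B" "hardy_le t g L"
  shows "hardy_le p h (A * K + B * L)"
  unfolding hardy_le_def
proof (intro allI impI)
  fix r :: real assume r: "0 < r" "r < 1"
  have int: "integrable circle_measure (\<lambda>\<zeta>. norm (f (of_real r * \<zeta>)) powr q)"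
    "integrable circle_measure (\<lambda>\<zeta>. norm (g (of_real r * \<zeta>)) powr t)"
    "integrable circle_measure (\<lambda>\<zeta>. norm (h (of_real r * \<zeta>)) powr p)"
    using f g h r pos by (auto intro!: integrable_circle continuous_on_dilate_powr)
  have "hardy_mean p h r
      \<le> (\<integral>\<zeta>. A * norm (f (of_real r * \<zeta>)) powr q + B * norm (g (of_real r * \<zeta>)) powr t \<partial>circle_measure)"
    unfolding hardy_mean_def
    by (rule integral_mono) (use int pw norm_scale_less[OF r] in auto)
  also have "\<dots> = A * hardy_mean q f r + B * hardy_mean t g r"
    unfolding hardy_mean_def using int by simp
  also have "\<dots> \<le> A * K + B * L"
    using A B r unfolding hardy_le_def by (intro add_mono mult_left_mono) auto
  finally show "hardy_mean p h r \<le> A * K + B * L" .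
qed

lemma norm_add_powr_le:
  fixes a b :: complex
  assumes "0 < p"
  shows "norm (a + b) powr p \<le> 2 powr p * norm a powr p + 2 powr p * norm b powr p"
proof -
  define M where "M = max (norm a) (norm b)"
  have "norm (a + b) powr p \<le> (2 * M) powr p"
    using norm_triangle_ineq[of a b] assms by (intro powr_mono2) (auto simp: M_def)
  also have "\<dots> = 2 powr p * M powr p" by (simp add: powr_mult M_def)
  also have "M powr p \<le> norm a powr p + norm b powr p" by (auto simp: M_def max_def)
  finally show ?thesis by (simp add: distrib_left)
qed

lemma hardy_le_diff:
  assumes "f holomorphic_on ball 0 1" "g holomorphic_on ball 0 1" "0 < p" "hardy_le p f K" "hardy_le p g L"
  shows "hardy_le p (\<lambda>z. f z - g z) (2 powr p * K + 2 powr p * L)"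
  using norm_add_powr_le[OF assms(3), of "f z" "- g z" for z] assms
  by (intro hardy_le_pointwise[of f g _ p p p]) (auto intro!: holomorphic_intros)

text \<open>An \<open>\<epsilon>\<close>-\<open>\<delta>\<close> form of the property that the difference of the composition operators maps sequences that
are bounded in the Hardy space and converge to 0 locally uniformly to sequences that converge to 0
in quasi-norm.\<close>

definition null_to_null :: "real \<Rightarrow> (complex \<Rightarrow> complex) \<Rightarrow> (complex \<Rightarrow> complex) \<Rightarrow> bool" where
  "null_to_null p \<phi> \<psi> \<longleftrightarrow>
     (\<forall>\<epsilon>>0. \<exists>\<rho> \<delta>. \<rho> < 1 \<and> 0 < \<delta> \<and>
        (\<forall>f. f holomorphic_on ball 0 1 \<longrightarrow> hardy_le p f 1 \<longrightarrow> (\<forall>z. norm z \<le> \<rho> \<longrightarrow> norm (f z) \<le> \<delta>) \<longrightarrow>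
             hardy_le p (\<lambda>z. f (\<phi> z) - f (\<psi> z)) \<epsilon>))"

lemma null_to_nullD:
  assumes "null_to_null p \<phi> \<psi>" and p: "0 < p" and \<epsilon>: "0 < \<epsilon>"
  obtains \<rho> \<delta> where "\<rho> < 1" "0 < \<delta>"
    "\<And>f. f holomorphic_on ball 0 1 \<Longrightarrow> hardy_le p f K \<Longrightarrow> (\<And>z. norm z \<le> \<rho> \<Longrightarrow> norm (f z) \<le> \<delta>) \<Longrightarrow>
       hardy_le p (\<lambda>z. f (\<phi> z) - f (\<psi> z)) \<epsilon>"
proof -
  define L where "L = max K 1"
  define c where "c = L powr (- (1 / p))"
  have L: "1 \<le> L" "K \<le> L" by (auto simp: L_def)
  have c: "0 < c" "c \<le> 1"
    using L p powr_mono[of "- (1 / p)" 0 L] by (auto simp: c_def)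
  have "c powr p = L powr (- 1)" unfolding c_def powr_powr using p by simp
  then have cp: "c powr p = 1 / L" using L by (simp add: powr_minus_divide)
  have \<epsilon>L: "0 < \<epsilon> / L" using \<epsilon> L by simp
  obtain \<rho> \<delta> where \<rho>: "\<rho> < 1" "0 < \<delta>"
    and *: "\<And>f. f holomorphic_on ball 0 1 \<Longrightarrow> hardy_le p f 1 \<Longrightarrow> (\<And>z. norm z \<le> \<rho> \<Longrightarrow> norm (f z) \<le> \<delta>) \<Longrightarrow>
       hardy_le p (\<lambda>z. f (\<phi> z) - f (\<psi> z)) (\<epsilon> / L)"
    using assms(1)[unfolded null_to_null_def, rule_format, OF \<epsilon>L] by blast
  show ?thesis
  proof (rule that[OF \<rho>])
    fix f assume f: "f holomorphic_on ball 0 1" "hardy_le p f K" "\<And>z. norm z \<le> \<rho> \<Longrightarrow> norm (f z) \<le> \<delta>"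
    have "hardy_le p (\<lambda>z. of_real c * f (\<phi> z) - of_real c * f (\<psi> z)) (\<epsilon> / L)"
    proof (rule *)
      show "(\<lambda>z. of_real c * f z) holomorphic_on ball 0 1" using f(1) by (intro holomorphic_intros)
      show "hardy_le p (\<lambda>z. of_real c * f z) 1"
        unfolding hardy_le_def
      proof (intro allI impI)
        fix r :: real assume r: "0 < r" "r < 1"
        have "c powr p * hardy_mean p f r \<le> c powr p * L"
          using hardy_le_mono[OF f(2) L(2)] r unfolding hardy_le_def by (intro mult_left_mono) auto
        then show "hardy_mean p (\<lambda>z. of_real c * f z) r \<le> 1"
          unfolding hardy_mean_cmult using L c cp by simp
      qed
      show "norm (of_real c * f z) \<le> \<delta>" if "norm z \<le> \<rho>" for z
        using f(3)[OF that] c mult_right_mono[of c 1 "norm (f z)"] by (simp add: norm_mult)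
    qed
    then have "hardy_le p (\<lambda>z. of_real c * (f (\<phi> z) - f (\<psi> z))) (\<epsilon> / L)"
      by (simp add: right_diff_distrib)
    then show "hardy_le p (\<lambda>z. f (\<phi> z) - f (\<psi> z)) \<epsilon>"
      using L c cp unfolding hardy_le_def hardy_mean_cmult by (simp add: field_simps)
  qed
qed

text \<open>Write a dilate of a small \<open>f\<close> as \<open>m * exp ((2 / q) * u)\<close>. The functions
\<open>g \<sigma> = m * exp ((2 / p + \<i> * \<sigma>) * u)\<close> are bounded in \<open>H\<^sup>p\<close>, because \<open>exp u\<close> is bounded in \<open>H\<^sup>2\<close> and the
imaginary part of \<open>u\<close> is bounded, and they are small on a compact set together with \<open>f\<close>. So the
hypothesis applies to \<open>g 0\<close> and \<open>g \<tau>\<close>, and the pointwise inequality, integrated over a circle, bounds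
the difference for \<open>f\<close>. The constants \<open>\<tau>\<close> and \<open>C\<close> of that inequality do not depend on \<open>f\<close>,
hence may be fixed before the compact set is chosen.\<close>

lemma null_to_null_transfer:
  assumes \<phi>: "holomorphic_self_map \<phi>" and \<psi>: "holomorphic_self_map \<psi>" and p: "0 < p" and q: "0 < q"
    and null: "null_to_null p \<phi> \<psi>"
  shows "null_to_null q \<phi> \<psi>"
  unfolding null_to_null_def
proof (intro allI impI)
  fix \<epsilon> :: real assume \<epsilon>: "0 < \<epsilon>"
  define L1 where "L1 = 80 / (1 - norm (\<phi> 0))\<^sup>2"
  define L2 where "L2 = 80 / (1 - norm (\<psi> 0))\<^sup>2"
  have L: "0 < L1" "0 < L2"
    using self_map_less[OF \<phi>, of 0] self_map_less[OF \<psi>, of 0] by (auto simp: L1_def L2_def)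
  define \<epsilon>1 where "\<epsilon>1 = \<epsilon> / (2 * (L1 + L2))"
  have \<epsilon>1: "0 < \<epsilon>1" using \<epsilon> L by (simp add: \<epsilon>1_def)
  obtain \<tau> C where \<tau>: "0 < \<tau>" and C: "0 < C" and core:
    "\<And>a b x y :: complex. \<bar>Im a\<bar> < pi / 2 \<Longrightarrow> \<bar>Im b\<bar> < pi / 2 \<Longrightarrow> norm x \<le> 1 \<Longrightarrow> norm y \<le> 1 \<Longrightarrow>
      norm (x * exp (of_real (2 / q) * a) - y * exp (of_real (2 / q) * b)) powr q
      \<le> \<epsilon>1 * (norm (exp a) powr 2 + norm (exp b) powr 2)
        + C * (norm (x * exp (of_real (2 / p) * a) - y * exp (of_real (2 / p) * b)) powr p
          + norm (x * exp ((of_real (2 / p) + \<i> * of_real \<tau>) * a)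
              - y * exp ((of_real (2 / p) + \<i> * of_real \<tau>) * b)) powr p)"
    by (rule two_test_functions[OF p q \<epsilon>1], rule that, assumption+)
  define E where "E = exp (\<tau> * (pi / 2))"
  have E: "1 \<le> E" using \<tau> by (simp add: E_def)
  define K where "K = E powr p * 80"
  have \<epsilon>2: "0 < \<epsilon> / (4 * C)" using \<epsilon> C by simp
  obtain \<rho> \<delta> where \<rho>: "\<rho> < 1" and \<delta>: "0 < \<delta>" and nl:
    "\<And>f. f holomorphic_on ball 0 1 \<Longrightarrow> hardy_le p f K \<Longrightarrow> (\<And>z. norm z \<le> \<rho> \<Longrightarrow> norm (f z) \<le> \<delta>) \<Longrightarrow>
       hardy_le p (\<lambda>z. f (\<phi> z) - f (\<psi> z)) (\<epsilon> / (4 * C))"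
    by (rule null_to_nullD[OF null p \<epsilon>2, of K], rule that, assumption, assumption, blast)
  \<comment> \<open>A bound for the factor by which the test functions exceed m on the disc of radius \<rho>: E accounts for the
    imaginary power.\<close>
  define G where "G = E * (8 / (1 - \<rho>)) powr (2 / p)"
  have G: "0 < G" using E \<rho> by (simp add: G_def)
  show "\<exists>\<rho> \<delta>. \<rho> < 1 \<and> 0 < \<delta> \<and>
        (\<forall>f. f holomorphic_on ball 0 1 \<longrightarrow> hardy_le q f 1 \<longrightarrow> (\<forall>z. norm z \<le> \<rho> \<longrightarrow> norm (f z) \<le> \<delta>) \<longrightarrow>
             hardy_le q (\<lambda>z. f (\<phi> z) - f (\<psi> z)) \<epsilon>)"
  proof (intro exI conjI allI impI)
    show "\<rho> < 1" "0 < \<delta> / G" using \<rho> \<delta> G by auto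
    fix f assume f: "f holomorphic_on ball 0 1" and f1: "hardy_le q f 1"
      and small: "\<forall>z. norm z \<le> \<rho> \<longrightarrow> norm (f z) \<le> \<delta> / G"
    have dil: "hardy_le q (\<lambda>z. f (of_real s * \<phi> z) - f (of_real s * \<psi> z)) \<epsilon>" if s: "0 < s" "s < 1" for s
    proof -
      have fs: "hardy_mean q f s \<le> 1" using f1 s by (simp add: hardy_le_def)
      obtain u m where hol: "u holomorphic_on ball 0 1" "m holomorphic_on ball 0 1"
        and fac: "\<And>z. norm z < 1 \<Longrightarrow> f (of_real s * z) = m z * exp (of_real (2 / q) * u z)"
        and m1: "\<And>z. norm z < 1 \<Longrightarrow> norm (m z) \<le> 1"
        and mf: "\<And>z. norm z < 1 \<Longrightarrow> norm (m z) \<le> norm (f (of_real s * z))"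
        and Imu: "\<And>z. norm z < 1 \<Longrightarrow> \<bar>Im (u z)\<bar> < pi / 2"
        and expu: "\<And>z. norm z < 1 \<Longrightarrow> norm (exp (u z)) \<le> 8 / (1 - norm z)"
        and mean_u: "\<And>\<phi>. holomorphic_self_map \<phi> \<Longrightarrow> hardy_le 2 (\<lambda>z. exp (u (\<phi> z))) (80 / (1 - norm (\<phi> 0))\<^sup>2)"
        by (rule sector_factorization[OF f q s fs], rule that, assumption+)
      have mean_u_id: "hardy_le 2 (\<lambda>z. exp (u z)) 80"
        using mean_u[of "\<lambda>z. z"] by (simp add: holomorphic_self_map_def)
      define g where "g = (\<lambda>\<sigma> z. m z * exp ((of_real (2 / p) + \<i> * of_real \<sigma>) * u z))"
      have hol_g: "g \<sigma> holomorphic_on ball 0 1" for \<sigma>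
        unfolding g_def by (intro holomorphic_intros hol)
      have norm_g: "norm (g \<sigma> z) \<le> E * (norm (m z) * norm (exp (u z)) powr (2 / p))"
        if z: "norm z < 1" and \<sigma>: "0 \<le> \<sigma>" "\<sigma> \<le> \<tau>" for \<sigma> z
      proof -
        have "\<bar>\<sigma> * Im (u z)\<bar> \<le> \<tau> * (pi / 2)"
          unfolding abs_mult using Imu[OF z] \<sigma> by (intro mult_mono) auto
        then have "- (\<sigma> * Im (u z)) \<le> \<tau> * (pi / 2)" by linarith
        then have "exp (- (\<sigma> * Im (u z))) \<le> E" by (simp add: E_def)
        moreover have "norm (exp ((of_real (2 / p) + \<i> * of_real \<sigma>) * u z)) =
            exp (- (\<sigma> * Im (u z))) * norm (exp (u z)) powr (2 / p)"
          by (simp add: powr_def algebra_simps del: of_real_divide flip: exp_add)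
        ultimately have "norm (exp ((of_real (2 / p) + \<i> * of_real \<sigma>) * u z)) \<le> E * norm (exp (u z)) powr (2 / p)"
          by (simp add: mult_right_mono)
        then have "norm (m z) * norm (exp ((of_real (2 / p) + \<i> * of_real \<sigma>) * u z))
            \<le> norm (m z) * (E * norm (exp (u z)) powr (2 / p))"
          by (intro mult_left_mono) auto
        then show ?thesis by (simp add: g_def norm_mult mult_ac)
      qed
      have Tg: "hardy_le p (\<lambda>z. g \<sigma> (\<phi> z) - g \<sigma> (\<psi> z)) (\<epsilon> / (4 * C))" if \<sigma>: "0 \<le> \<sigma>" "\<sigma> \<le> \<tau>" for \<sigma>
      proof (rule nl[OF hol_g])
        have "hardy_le p (g \<sigma>) (E powr p * 80 + 0 * 80)"
        proof (rule hardy_le_pointwise[where f="\<lambda>z. exp (u z)" and g="\<lambda>z. exp (u z)" and q=2 and t=2])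
          fix z :: complex assume z: "norm z < 1"
          have "norm (g \<sigma> z) \<le> E * norm (exp (u z)) powr (2 / p)"
          proof (rule order_trans[OF norm_g[OF z \<sigma>] mult_left_mono])
            show "norm (m z) * norm (exp (u z)) powr (2 / p) \<le> norm (exp (u z)) powr (2 / p)"
              using mult_right_mono[OF m1[OF z] powr_ge_zero] by simp
          qed (use E in simp)
          then have "norm (g \<sigma> z) powr p \<le> (E * norm (exp (u z)) powr (2 / p)) powr p"
            using p by (intro powr_mono2) auto
          also have "\<dots> = E powr p * norm (exp (u z)) powr 2"
            using p E by (simp add: powr_mult powr_powr)
          finally show "norm (g \<sigma> z) powr p \<le> E powr p * norm (exp (u z)) powr 2 + 0 * norm (exp (u z)) powr 2"
            by simp
        qed (use hol hol_g p mean_u_id in \<open>auto intro!: holomorphic_intros\<close>)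
        then show "hardy_le p (g \<sigma>) K" by (simp add: K_def)
        fix z :: complex assume z\<rho>: "norm z \<le> \<rho>"
        then have z: "norm z < 1" using \<rho> by simp
        have "norm (of_real s * z) \<le> \<rho>"
          using z\<rho> s mult_right_mono[of s 1 "norm z"] by (simp add: norm_mult)
        then have "norm (m z) \<le> \<delta> / G"
          using order_trans[OF mf[OF z]] small by blast
        moreover have "norm (exp (u z)) powr (2 / p) \<le> (8 / (1 - \<rho>)) powr (2 / p)"
        proof (rule powr_mono2)
          have "8 / (1 - norm z) \<le> 8 / (1 - \<rho>)" using z\<rho> \<rho> by (intro divide_left_mono) auto
          then show "norm (exp (u z)) \<le> 8 / (1 - \<rho>)" using expu[OF z] by linarith
        qed (use p in auto)
        ultimately have "norm (m z) * norm (exp (u z)) powr (2 / p) \<le> \<delta> / G * (8 / (1 - \<rho>)) powr (2 / p)"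
          using \<delta> G by (intro mult_mono) auto
        then have "E * (norm (m z) * norm (exp (u z)) powr (2 / p)) \<le> E * (\<delta> / G * (8 / (1 - \<rho>)) powr (2 / p))"
          using E by (intro mult_left_mono) auto
        also have "\<dots> = \<delta> / G * G" by (simp add: G_def)
        finally show "norm (g \<sigma> z) \<le> \<delta>"
          using norm_g[OF z \<sigma>] G by simp
      qed
      show ?thesis
        unfolding hardy_le_def
      proof (intro allI impI)
        fix r :: real assume r: "0 < r" "r < 1"
        let ?a = "\<lambda>\<zeta>. norm (exp (u (\<phi> (of_real r * \<zeta>)))) powr 2"
        let ?b = "\<lambda>\<zeta>. norm (exp (u (\<psi> (of_real r * \<zeta>)))) powr 2"
        let ?c = "\<lambda>\<sigma> \<zeta>. norm (g \<sigma> (\<phi> (of_real r * \<zeta>)) - g \<sigma> (\<psi> (of_real r * \<zeta>))) powr p"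
        have hol_T: "(\<lambda>z. h (\<phi> z) - h (\<psi> z)) holomorphic_on ball 0 1" if "h holomorphic_on ball 0 1" for h
          by (rule holomorphic_on_diff[OF holomorphic_on_compose_self_map[OF that \<phi>] holomorphic_on_compose_self_map[OF that \<psi>]])
        have hol_e: "(\<lambda>z. exp (u z)) holomorphic_on ball 0 1" by (intro holomorphic_intros hol)
        have int: "integrable circle_measure ?a" "integrable circle_measure ?b"
          "integrable circle_measure (?c 0)" "integrable circle_measure (?c \<tau>)"
          by (rule integrable_circle continuous_on_dilate_powr[OF holomorphic_on_compose_self_map[OF hol_e \<phi>] r]
              continuous_on_dilate_powr[OF holomorphic_on_compose_self_map[OF hol_e \<psi>] r]
              continuous_on_dilate_powr[OF hol_T[OF hol_g] r p] zero_less_numeral)+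
        have hol_s: "(\<lambda>z. f (of_real s * z)) holomorphic_on ball 0 1"
          using holomorphic_on_subset[OF holomorphic_on_dilate[OF f s]] by auto
        have "hardy_mean q (\<lambda>z. f (of_real s * \<phi> z) - f (of_real s * \<psi> z)) r
            \<le> (\<integral>\<zeta>. \<epsilon>1 * (?a \<zeta> + ?b \<zeta>) + C * (?c 0 \<zeta> + ?c \<tau> \<zeta>) \<partial>circle_measure)"
          unfolding hardy_mean_def
        proof (rule integral_mono)
          show "integrable circle_measure
              (\<lambda>\<zeta>. norm (f (of_real s * \<phi> (of_real r * \<zeta>)) - f (of_real s * \<psi> (of_real r * \<zeta>))) powr q)"
            using continuous_on_dilate_powr[OF hol_T[OF hol_s] r q] by (rule integrable_circle)
          fix \<zeta> assume "\<zeta> \<in> space circle_measure"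
          then have "norm (of_real r * \<zeta>) < 1" by (intro norm_scale_less r) auto
          then have d: "norm (\<phi> (of_real r * \<zeta>)) < 1" "norm (\<psi> (of_real r * \<zeta>)) < 1"
            using self_map_less \<phi> \<psi> by auto
          show "norm (f (of_real s * \<phi> (of_real r * \<zeta>)) - f (of_real s * \<psi> (of_real r * \<zeta>))) powr q
              \<le> \<epsilon>1 * (?a \<zeta> + ?b \<zeta>) + C * (?c 0 \<zeta> + ?c \<tau> \<zeta>)"
            using core[OF Imu[OF d(1)] Imu[OF d(2)] m1[OF d(1)] m1[OF d(2)]]
            unfolding fac[OF d(1)] fac[OF d(2)] g_def by simp
        qed (use int in auto)
        also have "\<dots> = \<epsilon>1 * (hardy_mean 2 (\<lambda>z. exp (u (\<phi> z))) r + hardy_mean 2 (\<lambda>z. exp (u (\<psi> z))) r)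
            + C * (hardy_mean p (\<lambda>z. g 0 (\<phi> z) - g 0 (\<psi> z)) r + hardy_mean p (\<lambda>z. g \<tau> (\<phi> z) - g \<tau> (\<psi> z)) r)"
          unfolding hardy_mean_def using int by simp
        also have "\<dots> \<le> \<epsilon>1 * (L1 + L2) + C * (\<epsilon> / (4 * C) + \<epsilon> / (4 * C))"
          using mean_u[OF \<phi>] mean_u[OF \<psi>] Tg[of 0] Tg[of \<tau>] \<tau> r \<epsilon>1 C
          unfolding hardy_le_def L1_def L2_def
          by (intro add_mono mult_left_mono) auto
        also have "\<dots> = \<epsilon>" using L C by (simp add: \<epsilon>1_def field_simps)
        finally show "hardy_mean q (\<lambda>z. f (of_real s * \<phi> z) - f (of_real s * \<psi> z)) r \<le> \<epsilon>" .
      qed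
    qed
    show "hardy_le q (\<lambda>z. f (\<phi> z) - f (\<psi> z)) \<epsilon>"
      unfolding hardy_le_def
    proof (intro allI impI)
      fix r :: real assume r: "0 < r" "r < 1"
      obtain \<rho>1 where \<rho>1: "\<rho>1 < 1" "\<And>\<zeta>. norm \<zeta> \<le> 1 \<Longrightarrow> norm (\<phi> (of_real r * \<zeta>)) \<le> \<rho>1"
        using self_map_radius[OF \<phi> r] by metis
      obtain \<rho>2 where \<rho>2: "\<rho>2 < 1" "\<And>\<zeta>. norm \<zeta> \<le> 1 \<Longrightarrow> norm (\<psi> (of_real r * \<zeta>)) \<le> \<rho>2"
        using self_map_radius[OF \<psi> r] by metis
      have le: "norm (\<phi> (of_real r * \<zeta>)) \<le> max \<rho>1 \<rho>2" "norm (\<psi> (of_real r * \<zeta>)) \<le> max \<rho>1 \<rho>2"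
        if "norm \<zeta> = 1" for \<zeta>
        using \<rho>1(2)[of \<zeta>] \<rho>2(2)[of \<zeta>] that by auto
      obtain s B where s: "\<And>n. 0 < s n" "\<And>n. s n < 1"
        and B: "\<And>n w. norm w \<le> max \<rho>1 \<rho>2 \<Longrightarrow> norm (f (of_real (s n) * w)) \<le> B"
        and lim: "\<And>w. norm w \<le> max \<rho>1 \<rho>2 \<Longrightarrow> (\<lambda>n. f (of_real (s n) * w)) \<longlonglongrightarrow> f w"
        using dilate_limit[OF f, of "max \<rho>1 \<rho>2"] \<rho>1(1) \<rho>2(1) by (metis max_less_iff_conj)
      have hol_T: "(\<lambda>z. h (\<phi> z) - h (\<psi> z)) holomorphic_on ball 0 1" if "h holomorphic_on ball 0 1" for h
        by (rule holomorphic_on_diff[OF holomorphic_on_compose_self_map[OF that \<phi>] holomorphic_on_compose_self_map[OF that \<psi>]])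
      have hol_s: "(\<lambda>z. f (of_real (s n) * z)) holomorphic_on ball 0 1" for n
        using holomorphic_on_subset[OF holomorphic_on_dilate[OF f s]] by auto
      have "(\<lambda>n. hardy_mean q (\<lambda>z. f (of_real (s n) * \<phi> z) - f (of_real (s n) * \<psi> z)) r)
          \<longlonglongrightarrow> hardy_mean q (\<lambda>z. f (\<phi> z) - f (\<psi> z)) r"
        unfolding hardy_mean_def
      proof (rule circle_integral_tendsto[where B="(B + B) powr q"])
        fix n and \<zeta> :: complex assume \<zeta>: "norm \<zeta> = 1"
        have "norm (f (of_real (s n) * \<phi> (of_real r * \<zeta>)) - f (of_real (s n) * \<psi> (of_real r * \<zeta>))) \<le> B + B"
          using B[OF le(1)[OF \<zeta>], of n] B[OF le(2)[OF \<zeta>], of n] by (intro order_trans[OF norm_triangle_ineq4] add_mono)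
        then show "norm (norm (f (of_real (s n) * \<phi> (of_real r * \<zeta>)) - f (of_real (s n) * \<psi> (of_real r * \<zeta>))) powr q)
            \<le> (B + B) powr q"
          using q by (auto intro!: powr_mono2)
      next
        fix \<zeta> :: complex assume \<zeta>: "norm \<zeta> = 1"
        show "(\<lambda>n. norm (f (of_real (s n) * \<phi> (of_real r * \<zeta>)) - f (of_real (s n) * \<psi> (of_real r * \<zeta>))) powr q)
            \<longlonglongrightarrow> norm (f (\<phi> (of_real r * \<zeta>)) - f (\<psi> (of_real r * \<zeta>))) powr q"
          by (intro powr_norm_tendsto tendsto_diff lim le \<zeta> q)
      qed (rule continuous_on_dilate_powr[OF hol_T[OF hol_s] r q] continuous_on_dilate_powr[OF hol_T[OF f] r q])+
      then show "hardy_mean q (\<lambda>z. f (\<phi> z) - f (\<psi> z)) r \<le> \<epsilon>"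
        using dil[OF s] r unfolding hardy_le_def by (intro LIMSEQ_le_const2) auto
    qed
  qed
qed

section \<open>The Hardy space as a metric space\<close>

lemma hardy_sup_le_iff:
  assumes f: "f holomorphic_on ball 0 1" and p: "0 < p" and K: "0 \<le> K"
  shows "hardy_sup p f \<le> ennreal K \<longleftrightarrow> hardy_le p f K"
proof -
  have "(\<integral>\<^sup>+ \<zeta>. ennreal (norm (f (of_real r * \<zeta>)) powr p) \<partial>circle_measure) = ennreal (hardy_mean p f r)"
    if "0 < r" "r < 1" for r
    unfolding hardy_mean_def
    by (rule nn_integral_eq_integral)
       (use continuous_on_dilate_powr[OF f that p] in \<open>auto intro!: integrable_circle\<close>)
  then show ?thesis
    unfolding hardy_sup_def hardy_le_def SUP_le_iff using K by (auto simp: ennreal_le_iff)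
qed

lemma hardy_space_iff:
  assumes p: "0 < p"
  shows "f \<in> hardy_space p \<longleftrightarrow>
    f holomorphic_on ball 0 1 \<and> (\<forall>z. z \<notin> ball 0 1 \<longrightarrow> f z = 0) \<and> (\<exists>K\<ge>0. hardy_le p f K)"
proof -
  have "hardy_sup p f < \<infinity> \<longleftrightarrow> (\<exists>K\<ge>0. hardy_le p f K)" if f: "f holomorphic_on ball 0 1"
  proof
    assume "hardy_sup p f < \<infinity>"
    then obtain K where "0 \<le> K" "hardy_sup p f = ennreal K"
      by (cases "hardy_sup p f") auto
    then show "\<exists>K\<ge>0. hardy_le p f K"
      using hardy_sup_le_iff[OF f p] by (metis order_refl)
  next
    assume "\<exists>K\<ge>0. hardy_le p f K"
    then obtain K where "0 \<le> K" "hardy_sup p f \<le> ennreal K"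
      using hardy_sup_le_iff[OF f p] by metis
    then show "hardy_sup p f < \<infinity>"
      by (metis ennreal_less_top infinity_ennreal_def order_le_less_trans)
  qed
  then show ?thesis by (auto simp: hardy_space_def)
qed

lemma hardy_norm_le_iff:
  assumes p: "0 < p" and f: "f \<in> hardy_space p" and c: "0 \<le> c"
  shows "hardy_norm p f \<le> c \<longleftrightarrow> hardy_le p f (c powr p)"
proof -
  have hol: "f holomorphic_on ball 0 1" and fin: "hardy_sup p f < \<infinity>"
    using f by (auto simp: hardy_space_def)
  define M where "M = enn2real (hardy_sup p f)"
  have M: "0 \<le> M" "hardy_sup p f = ennreal M" using fin by (auto simp: M_def)
  have "hardy_le p f (c powr p) \<longleftrightarrow> M \<le> c powr p"
    unfolding hardy_sup_le_iff[OF hol p powr_ge_zero, symmetric] M(2) by (simp add: ennreal_le_iff)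
  also have "\<dots> \<longleftrightarrow> M powr (1 / p) \<le> c"
  proof
    assume "M \<le> c powr p"
    then have "M powr (1 / p) \<le> (c powr p) powr (1 / p)" using M p by (intro powr_mono2) auto
    then show "M powr (1 / p) \<le> c" using c p by (simp add: powr_powr)
  next
    assume "M powr (1 / p) \<le> c"
    then have "(M powr (1 / p)) powr p \<le> c powr p" using p by (intro powr_mono2) auto
    then show "M \<le> c powr p" using M p by (simp add: powr_powr)
  qed
  finally show ?thesis by (simp add: hardy_norm_def M_def)
qed

lemma hardy_norm_nonneg [simp]: "0 \<le> hardy_norm p f"
  by (simp add: hardy_norm_def)

lemma hardy_le_norm:
  assumes "0 < p" "f \<in> hardy_space p"
  shows "hardy_le p f (hardy_norm p f powr p)"
  using hardy_norm_le_iff[OF assms hardy_norm_nonneg] by blast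

lemma hardy_space_diff:
  assumes p: "0 < p" and "f \<in> hardy_space p" "g \<in> hardy_space p"
  shows "f - g \<in> hardy_space p"
proof -
  obtain K L where "0 \<le> K" "hardy_le p f K" "0 \<le> L" "hardy_le p g L"
    using assms unfolding hardy_space_iff[OF p] by blast
  then have "hardy_le p (\<lambda>z. f z - g z) (2 powr p * K + 2 powr p * L)" "0 \<le> 2 powr p * K + 2 powr p * L"
    using assms by (auto simp: hardy_space_def intro!: hardy_le_diff)
  then show ?thesis
    using assms unfolding hardy_space_iff[OF p] fun_diff_def by (auto intro!: holomorphic_intros)
qed

lemma hardy_norm_minus_commute: "hardy_norm p (f - g) = hardy_norm p (g - f)"
  unfolding hardy_norm_def hardy_sup_def by (simp add: norm_minus_commute)

lemma powr_add_subadditive: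
  fixes a b p :: real
  assumes "0 \<le> a" "0 \<le> b" "0 < p" "p \<le> 1"
  shows "(a + b) powr p \<le> a powr p + b powr p"
proof (cases "a + b = 0")
  case False
  then have s: "0 < a + b" using assms by linarith
  have *: "x / (a + b) * (a + b) powr p \<le> x powr p" if x: "0 \<le> x" "x \<le> a + b" for x
  proof -
    have "(x / (a + b)) powr 1 \<le> (x / (a + b)) powr p"
      using x s assms by (intro powr_mono') auto
    then have "x / (a + b) * (a + b) powr p \<le> (x / (a + b)) powr p * (a + b) powr p"
      using x s by (intro mult_right_mono) auto
    also have "\<dots> = x powr p" using x s by (simp flip: powr_mult)
    finally show ?thesis .
  qed
  have "a / (a + b) + b / (a + b) = 1" using s by (simp flip: add_divide_distrib)
  then have "(a + b) powr p = a / (a + b) * (a + b) powr p + b / (a + b) * (a + b) powr p"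
    by (simp only: distrib_right[symmetric] mult_1_left)
  also have "\<dots> \<le> a powr p + b powr p"
    using assms by (intro add_mono *) auto
  finally show ?thesis .
qed (use assms in auto)

lemma convex_powr:
  fixes x y t p :: real
  assumes "1 \<le> p" "0 \<le> x" "0 \<le> y" "0 \<le> t" "t \<le> 1"
  shows "((1 - t) * x + t * y) powr p \<le> (1 - t) * x powr p + t * y powr p"
proof -
  have le: "(s * z) powr p \<le> s * z powr p" if "0 \<le> s" "s \<le> 1" "0 \<le> z" for s z
  proof -
    have "s powr p \<le> s powr 1" using that assms by (intro powr_mono') auto
    then show ?thesis using that by (simp add: powr_mult mult_right_mono)
  qed
  show ?thesis
  proof (cases "x = 0 \<or> y = 0")
    case True
    then show ?thesis using le[of t y] le[of "1 - t" x] assms by auto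
  next
    case False
    then show ?thesis
      using convex_onD[OF powr_convex[OF assms(1)], of t x y] assms by auto
  qed
qed

text \<open>For \<open>p \<le> 1\<close> the \<open>p\<close>-th power of the quasi-norm is subadditive; for \<open>p \<ge> 1\<close> this is Minkowski's
inequality, obtained from convexity of the power by normalizing both summands. The positive \<open>\<eta>\<close> in
the proof keeps the normalizing constants away from 0.\<close>

lemma hardy_norm_triangle:
  assumes p: "0 < p" and f: "f \<in> hardy_space p" and g: "g \<in> hardy_space p" and fg: "(\<lambda>z. f z + g z) \<in> hardy_space p"
  shows "hardy_norm p (\<lambda>z. f z + g z) powr min 1 p \<le> hardy_norm p f powr min 1 p + hardy_norm p g powr min 1 p"
proof -
  have hol: "f holomorphic_on ball 0 1" "g holomorphic_on ball 0 1" "(\<lambda>z. f z + g z) holomorphic_on ball 0 1"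
    using f g by (auto simp: hardy_space_def intro!: holomorphic_intros)
  note N = hardy_le_norm[OF p f] hardy_le_norm[OF p g]
  show ?thesis
  proof (cases "p \<le> 1")
    case True
    define S where "S = hardy_norm p f powr p + hardy_norm p g powr p"
    have S: "0 \<le> S" by (simp add: S_def)
    have "hardy_le p (\<lambda>z. f z + g z) (1 * hardy_norm p f powr p + 1 * hardy_norm p g powr p)"
    proof (rule hardy_le_pointwise[OF hol p p p _ _ N(1) _ N(2)])
      fix z
      have "norm (f z + g z) powr p \<le> (norm (f z) + norm (g z)) powr p"
        using p by (intro powr_mono2 norm_triangle_ineq) auto
      also have "\<dots> \<le> norm (f z) powr p + norm (g z) powr p"
        using True p by (intro powr_add_subadditive) auto
      finally show "norm (f z + g z) powr p \<le> 1 * norm (f z) powr p + 1 * norm (g z) powr p" by simp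
    qed auto
    then have "hardy_le p (\<lambda>z. f z + g z) ((S powr (1 / p)) powr p)"
      using S p by (simp add: powr_powr S_def)
    then have "hardy_norm p (\<lambda>z. f z + g z) \<le> S powr (1 / p)"
      using hardy_norm_le_iff[OF p fg powr_ge_zero] by blast
    then have "hardy_norm p (\<lambda>z. f z + g z) powr p \<le> (S powr (1 / p)) powr p"
      using p by (intro powr_mono2) auto
    then show ?thesis using True S p by (simp add: powr_powr S_def min_def)
  next
    case False
    then have p1: "1 \<le> p" by simp
    have "hardy_norm p (\<lambda>z. f z + g z) \<le> hardy_norm p f + hardy_norm p g"
    proof (rule field_le_epsilon)
      fix \<eta> :: real assume \<eta>: "0 < \<eta>"
      define a where "a = hardy_norm p f + \<eta> / 2"
      define b where "b = hardy_norm p g + \<eta> / 2"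
      have ab: "0 < a" "0 < b" "hardy_norm p f \<le> a" "hardy_norm p g \<le> b"
        using \<eta> by (auto simp: a_def b_def add_nonneg_pos)
      define t where "t = b / (a + b)"
      have t: "0 \<le> t" "t \<le> 1" "(1 - t) * (a + b) = a" "t * (a + b) = b"
        using ab by (auto simp: t_def field_simps)
      have "hardy_le p (\<lambda>z. f z + g z)
          ((a + b) powr p * (1 - t) / a powr p * a powr p + (a + b) powr p * t / b powr p * b powr p)"
      proof (rule hardy_le_pointwise[OF hol p p p])
        show "hardy_le p f (a powr p)" "hardy_le p g (b powr p)"
          using hardy_norm_le_iff[OF p f] hardy_norm_le_iff[OF p g] ab by auto
        fix z
        have "norm (f z + g z) \<le> norm (f z) + norm (g z)" by (rule norm_triangle_ineq)
        also have "\<dots> = (a + b) * ((1 - t) * (norm (f z) / a) + t * (norm (g z) / b))"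
          using t ab by (simp add: distrib_left mult.assoc[symmetric] mult.commute[of "a + b"])
        finally have "norm (f z + g z) powr p \<le> ((a + b) * ((1 - t) * (norm (f z) / a) + t * (norm (g z) / b))) powr p"
          using p by (intro powr_mono2) auto
        also have "\<dots> = (a + b) powr p * ((1 - t) * (norm (f z) / a) + t * (norm (g z) / b)) powr p"
          using ab t by (intro powr_mult)
        also have "\<dots> \<le> (a + b) powr p * ((1 - t) * (norm (f z) / a) powr p + t * (norm (g z) / b) powr p)"
          using ab t p1 by (intro mult_left_mono convex_powr) auto
        also have "\<dots> = (a + b) powr p * (1 - t) / a powr p * norm (f z) powr p + (a + b) powr p * t / b powr p * norm (g z) powr p"
          using ab by (simp add: powr_divide distrib_left)
        finally show "norm (f z + g z) powr p \<le> (a + b) powr p * (1 - t) / a powr p * norm (f z) powr p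
            + (a + b) powr p * t / b powr p * norm (g z) powr p" .
      qed (use t in auto)
      also have "(a + b) powr p * (1 - t) / a powr p * a powr p + (a + b) powr p * t / b powr p * b powr p = (a + b) powr p"
        using ab by (simp add: distrib_left[symmetric])
      finally have "hardy_norm p (\<lambda>z. f z + g z) \<le> a + b"
        using hardy_norm_le_iff[OF p fg, of "a + b"] ab by auto
      then show "hardy_norm p (\<lambda>z. f z + g z) \<le> hardy_norm p f + hardy_norm p g + \<eta>" by (simp add: a_def b_def)
    qed
    then show ?thesis using p1 by (simp add: min_def)
  qed
qed

lemma hardy_norm_point_estimate:
  assumes p: "0 < p" and f: "f \<in> hardy_space p" and z: "norm z < 1"
  shows "norm (f z) powr p \<le> 2 / (1 - norm z) * hardy_norm p f powr p"
  using f z p by (intro hardy_point_estimate hardy_le_norm) (auto simp: hardy_space_def)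

definition hardy_dist :: "real \<Rightarrow> (complex \<Rightarrow> complex) \<Rightarrow> (complex \<Rightarrow> complex) \<Rightarrow> real" where
  "hardy_dist p f g = hardy_norm p (f - g) powr min 1 p"

lemma Metric_space_hardy:
  assumes p: "0 < p"
  shows "Metric_space (hardy_space p) (hardy_dist p)"
proof
  show "0 \<le> hardy_dist p f g" for f g by (simp add: hardy_dist_def)
  show "hardy_dist p f g = hardy_dist p g f" for f g
    by (simp add: hardy_dist_def hardy_norm_minus_commute[of p f])
  show "hardy_dist p f g = 0 \<longleftrightarrow> f = g" if f: "f \<in> hardy_space p" and g: "g \<in> hardy_space p" for f g
  proof
    assume "hardy_dist p f g = 0"
    then have N: "hardy_norm p (f - g) = 0" by (simp add: hardy_dist_def)
    show "f = g"
    proof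
      fix z show "f z = g z"
      proof (cases "norm z < 1")
        case True
        from hardy_norm_point_estimate[OF p hardy_space_diff[OF p f g] True] N p
        have "norm (f z - g z) powr p \<le> 0" by simp
        then have "norm (f z - g z) powr p = 0" using powr_ge_zero[of "norm (f z - g z)" p] by linarith
        then show ?thesis by simp
      next
        case False
        then show ?thesis using f g by (auto simp: hardy_space_def)
      qed
    qed
  next
    assume "f = g"
    then have "hardy_le p (f - g) (0 powr p)" using p by (simp add: hardy_le_def hardy_mean_def)
    then have "hardy_norm p (f - g) \<le> 0"
      using hardy_norm_le_iff[OF p hardy_space_diff[OF p f g] order_refl] by blast
    then show "hardy_dist p f g = 0" using hardy_norm_nonneg[of p "f - g"] by (simp add: hardy_dist_def)
  qed
  show "hardy_dist p f h \<le> hardy_dist p f g + hardy_dist p g h"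
    if "f \<in> hardy_space p" "g \<in> hardy_space p" "h \<in> hardy_space p" for f g h
  proof -
    have "f - h = (\<lambda>z. (f - g) z + (g - h) z)" by (simp add: fun_eq_iff)
    then show ?thesis
      using hardy_norm_triangle[OF p hardy_space_diff[OF p that(1,2)] hardy_space_diff[OF p that(2,3)]]
        hardy_space_diff[OF p that(1,3)]
      by (simp only: hardy_dist_def)
  qed
qed

text \<open>Once the topology comes from a metric, compactness can be tested on sequences and compact sets are
closed.\<close>

lemma quasinorm_topology_hardy:
  assumes p: "0 < p"
  shows "quasinorm_topology (hardy_space p) (hardy_norm p) = Metric_space.mtopology (hardy_space p) (hardy_dist p)"
proof -
  interpret Metric_space "hardy_space p" "hardy_dist p" by (rule Metric_space_hardy[OF p])
  define \<alpha> where "\<alpha> = min 1 p"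
  have \<alpha>: "0 < \<alpha>" using p by (simp add: \<alpha>_def)
  have d: "hardy_dist p f g = hardy_norm p (g - f) powr \<alpha>" for f g
    by (simp add: hardy_dist_def \<alpha>_def hardy_norm_minus_commute)
  have "(\<exists>\<epsilon>>0. \<forall>g\<in>hardy_space p. hardy_norm p (g - f) < \<epsilon> \<longrightarrow> g \<in> U) \<longleftrightarrow> (\<exists>r>0. mball f r \<subseteq> U)"
    if f: "f \<in> hardy_space p" for f U
  proof
    assume "\<exists>\<epsilon>>0. \<forall>g\<in>hardy_space p. hardy_norm p (g - f) < \<epsilon> \<longrightarrow> g \<in> U"
    then obtain \<epsilon> where \<epsilon>: "0 < \<epsilon>" "\<And>g. g \<in> hardy_space p \<Longrightarrow> hardy_norm p (g - f) < \<epsilon> \<Longrightarrow> g \<in> U" by blast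
    have "mball f (\<epsilon> powr \<alpha>) \<subseteq> U"
    proof
      fix g assume "g \<in> mball f (\<epsilon> powr \<alpha>)"
      then have g: "g \<in> hardy_space p" "hardy_norm p (g - f) powr \<alpha> < \<epsilon> powr \<alpha>" by (auto simp: d)
      have "hardy_norm p (g - f) < \<epsilon>"
      proof (rule ccontr)
        assume "\<not> ?thesis"
        then have "\<epsilon> powr \<alpha> \<le> hardy_norm p (g - f) powr \<alpha>" using \<epsilon> \<alpha> by (intro powr_mono2) auto
        then show False using g by simp
      qed
      then show "g \<in> U" using \<epsilon> g by blast
    qed
    then show "\<exists>r>0. mball f r \<subseteq> U" using \<epsilon> by (intro exI[of _ "\<epsilon> powr \<alpha>"]) auto
  next
    assume "\<exists>r>0. mball f r \<subseteq> U"
    then obtain r where r: "0 < r" "mball f r \<subseteq> U" by blast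
    have "g \<in> U" if g: "g \<in> hardy_space p" "hardy_norm p (g - f) < r powr (1 / \<alpha>)" for g
    proof -
      have "hardy_norm p (g - f) powr \<alpha> < (r powr (1 / \<alpha>)) powr \<alpha>"
        using g \<alpha> by (intro powr_less_mono2) auto
      then have "hardy_dist p f g < r" using r \<alpha> by (simp add: d powr_powr)
      then show ?thesis using r f g by auto
    qed
    then show "\<exists>\<epsilon>>0. \<forall>g\<in>hardy_space p. hardy_norm p (g - f) < \<epsilon> \<longrightarrow> g \<in> U"
      using r by (intro exI[of _ "r powr (1 / \<alpha>)"]) auto
  qed
  then show ?thesis
    unfolding topology_eq openin_quasinorm_topology openin_mtopology by blast
qed

section \<open>Compactness\<close>

abbreviation composition_difference ::
  "(complex \<Rightarrow> complex) \<Rightarrow> (complex \<Rightarrow> complex) \<Rightarrow> (complex \<Rightarrow> complex) \<Rightarrow> complex \<Rightarrow> complex" where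
  "composition_difference \<phi> \<psi> \<equiv> \<lambda>f. composition_operator \<phi> f - composition_operator \<psi> f"

lemma hardy_le_composition_difference:
  "hardy_le p (composition_difference \<phi> \<psi> f) K \<longleftrightarrow> hardy_le p (\<lambda>z. f (\<phi> z) - f (\<psi> z)) K"
  by (rule hardy_le_cong) (simp add: composition_operator_def)

lemma composition_difference_hardy_space:
  assumes p: "0 < p" and \<phi>: "holomorphic_self_map \<phi>" and \<psi>: "holomorphic_self_map \<psi>"
    and f: "f \<in> hardy_space p"
  shows "composition_difference \<phi> \<psi> f \<in> hardy_space p"
proof -
  obtain K where hol: "f holomorphic_on ball 0 1" and K: "0 \<le> K" "hardy_le p f K"
    using f unfolding hardy_space_iff[OF p] by blast
  note comp = holomorphic_on_compose_self_map[OF hol \<phi>] holomorphic_on_compose_self_map[OF hol \<psi>]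
  define L where "L = 2 powr p * (2 / (1 - norm (\<phi> 0)) * K) + 2 powr p * (2 / (1 - norm (\<psi> 0)) * K)"
  have "hardy_le p (\<lambda>z. f (\<phi> z) - f (\<psi> z)) L"
    unfolding L_def
    by (intro hardy_le_diff comp p littlewood_subordination[OF hol p K(2)] \<phi> \<psi>)
  moreover have "0 \<le> L"
    using K self_map_less[OF \<phi>, of 0] self_map_less[OF \<psi>, of 0] by (auto simp: L_def intro!: add_nonneg_nonneg mult_nonneg_nonneg)
  moreover have "composition_difference \<phi> \<psi> f holomorphic_on ball 0 1"
    using holomorphic_on_diff[OF comp]
    by (rule holomorphic_transform) (simp add: composition_operator_def)
  ultimately show ?thesis
    unfolding hardy_space_iff[OF p] hardy_le_composition_difference
    by (auto simp: composition_operator_def)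
qed

text \<open>A nonzero function in the compact closure of the image of the ball has a nonzero value at some
point \<open>z\<close>, and point evaluations are continuous. So the closure is covered by a ball about 0 and the open sets
\<open>V (z, c)\<close> of functions with modulus above \<open>c\<close> at \<open>z\<close>. A finite subcover involves finitely
many points only. If \<open>f\<close> is small at the images of these points under \<open>\<phi>\<close> and \<open>\<psi>\<close>, then its image
lies in none of the sets \<open>V (z, c)\<close>, hence in the ball about 0.\<close>

lemma compact_imp_null_to_null:
  assumes p: "0 < p" and \<phi>: "holomorphic_self_map \<phi>" and \<psi>: "holomorphic_self_map \<psi>"
    and cpt: "compact_on_hardy p (composition_difference \<phi> \<psi>)"
  shows "null_to_null p \<phi> \<psi>"
  unfolding null_to_null_def
proof (intro allI impI)
  fix \<epsilon> :: real assume \<epsilon>: "0 < \<epsilon>"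
  interpret Metric_space "hardy_space p" "hardy_dist p" by (rule Metric_space_hardy[OF p])
  let ?T = "composition_difference \<phi> \<psi>"
  let ?B = "{f \<in> hardy_space p. hardy_norm p f \<le> 1}"
  define X where "X = quasinorm_topology (hardy_space p) (hardy_norm p)"
  have X: "X = mtopology" unfolding X_def by (rule quasinorm_topology_hardy[OF p])
  define S where "S = X closure_of (?T ` ?B)"
  have S: "compactin X S" "?T ` ?B \<subseteq> S"
    using cpt closure_of_subset[of "?T ` ?B" X]
    unfolding compact_operator_def relatively_compactin_def S_def X_def by auto
  have S_sub: "S \<subseteq> hardy_space p" using compactin_subset_topspace[OF S(1)] by (simp add: X)
  define V0 where "V0 = mball (\<lambda>_. 0) ((\<epsilon> powr (1 / p)) powr min 1 p)"
  define V where "V = (\<lambda>(z, c). {g \<in> hardy_space p. c < norm (g z)})"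
  have zero: "(\<lambda>_. 0) \<in> hardy_space p"
    using p unfolding hardy_space_iff[OF p] by (auto simp: hardy_le_def hardy_mean_def intro!: exI[of _ 0])
  have V0_le: "hardy_le p g \<epsilon>" if "g \<in> V0" for g
  proof -
    have g: "g \<in> hardy_space p" and less: "hardy_norm p g powr min 1 p < (\<epsilon> powr (1 / p)) powr min 1 p"
      using that hardy_norm_minus_commute[of p "\<lambda>_. 0" g] by (auto simp: V0_def hardy_dist_def fun_diff_def)
    have "hardy_norm p g \<le> \<epsilon> powr (1 / p)"
    proof (rule ccontr)
      assume "\<not> ?thesis"
      then have "(\<epsilon> powr (1 / p)) powr min 1 p \<le> hardy_norm p g powr min 1 p"
        using p by (intro powr_mono2) auto
      then show False using less by simp
    qed
    then show ?thesis
      using hardy_norm_le_iff[OF p g, of "\<epsilon> powr (1 / p)"] p \<epsilon> by (simp add: powr_powr)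
  qed
  have V_open: "openin X (V (z, c))" if z: "norm z < 1" for z c
    unfolding X_def openin_quasinorm_topology
  proof (intro conjI ballI)
    show "V (z, c) \<subseteq> hardy_space p" by (auto simp: V_def)
    fix g assume "g \<in> V (z, c)"
    then have g: "g \<in> hardy_space p" "c < norm (g z)" by (auto simp: V_def)
    define \<eta> where "\<eta> = norm (g z) - c"
    define e where "e = ((1 - norm z) / 2) powr (1 / p) * \<eta>"
    have \<eta>: "0 < \<eta>" and e: "0 < e" using g z by (auto simp: \<eta>_def e_def)
    have "g' \<in> V (z, c)" if g': "g' \<in> hardy_space p" "hardy_norm p (g' - g) < e" for g'
    proof -
      have "norm (g' z - g z) powr p \<le> 2 / (1 - norm z) * hardy_norm p (g' - g) powr p"
        using hardy_norm_point_estimate[OF p hardy_space_diff[OF p g'(1) g(1)] z] by simp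
      also have "\<dots> < 2 / (1 - norm z) * e powr p"
        using g'(2) z p by (intro mult_strict_left_mono powr_less_mono2) auto
      also have "\<dots> = \<eta> powr p"
        using z p \<eta> by (simp add: e_def powr_mult powr_powr)
      finally have "norm (g' z - g z) < \<eta>"
        using p \<eta> by (smt (verit) norm_ge_zero powr_mono2)
      then have "c < norm (g' z)"
        using norm_triangle_ineq2[of "g z" "g' z"] by (simp add: \<eta>_def norm_minus_commute)
      then show ?thesis using g' by (simp add: V_def)
    qed
    then show "\<exists>\<epsilon>>0. \<forall>g'\<in>hardy_space p. hardy_norm p (g' - g) < \<epsilon> \<longrightarrow> g' \<in> V (z, c)"
      using e by blast
  qed
  define I where "I = ball (0::complex) 1 \<times> {0::real<..}"
  have "S \<subseteq> \<Union> (insert V0 (V ` I))"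
  proof
    fix g assume "g \<in> S"
    then have g: "g \<in> hardy_space p" using S_sub by blast
    show "g \<in> \<Union> (insert V0 (V ` I))"
    proof (cases "g = (\<lambda>_. 0)")
      case True
      then show ?thesis using zero \<epsilon> by (auto simp: V0_def)
    next
      case False
      then obtain z where "g z \<noteq> 0" by blast
      moreover from this have "norm z < 1" using g by (force simp: hardy_space_def)
      ultimately have "g \<in> V (z, norm (g z) / 2)" "(z, norm (g z) / 2) \<in> I"
        using g by (auto simp: V_def I_def)
      then show ?thesis by blast
    qed
  qed
  moreover have "openin X U" if "U \<in> insert V0 (V ` I)" for U
    using that V_open by (auto simp: I_def V0_def X openin_mball)
  ultimately obtain F where F: "finite F" "F \<subseteq> insert V0 (V ` I)" "S \<subseteq> \<Union> F"
    using S(1) unfolding compactin_def by meson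
  have "finite (F - {V0})" "F - {V0} \<subseteq> V ` I" using F by auto
  then obtain A where A: "finite A" "A \<subseteq> I" "F - {V0} = V ` A"
    by (meson finite_subset_image)
  from A(1,2) have "\<exists>\<rho> \<delta>. \<rho> < 1 \<and> 0 < \<delta> \<and> (\<forall>(z, c)\<in>A. norm (\<phi> z) \<le> \<rho> \<and> norm (\<psi> z) \<le> \<rho> \<and> 2 * \<delta> \<le> c)"
  proof (induction A rule: finite_induct)
    case empty
    show ?case by (intro exI[of _ 0] exI[of _ 1]) auto
  next
    case (insert w A)
    obtain z c where w: "w = (z, c)" "norm z < 1" "0 < c" using insert.prems by (cases w) (auto simp: I_def)
    obtain \<rho> \<delta> where "\<rho> < 1" "0 < \<delta>" "\<forall>(z, c)\<in>A. norm (\<phi> z) \<le> \<rho> \<and> norm (\<psi> z) \<le> \<rho> \<and> 2 * \<delta> \<le> c"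
      using insert by auto
    then show ?case
      using w self_map_less[OF \<phi>, of z] self_map_less[OF \<psi>, of z]
      by (intro exI[of _ "max \<rho> (max (norm (\<phi> z)) (norm (\<psi> z)))"] exI[of _ "min \<delta> (c / 2)"]) fastforce
  qed
  then obtain \<rho> \<delta> where \<rho>: "\<rho> < 1" "0 < \<delta>"
    "\<And>z c. (z, c) \<in> A \<Longrightarrow> norm (\<phi> z) \<le> \<rho> \<and> norm (\<psi> z) \<le> \<rho> \<and> 2 * \<delta> \<le> c" by fast
  show "\<exists>\<rho> \<delta>. \<rho> < 1 \<and> 0 < \<delta> \<and>
        (\<forall>f. f holomorphic_on ball 0 1 \<longrightarrow> hardy_le p f 1 \<longrightarrow> (\<forall>z. norm z \<le> \<rho> \<longrightarrow> norm (f z) \<le> \<delta>) \<longrightarrow>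
             hardy_le p (\<lambda>z. f (\<phi> z) - f (\<psi> z)) \<epsilon>)"
  proof (intro exI conjI allI impI)
    fix f assume f: "f holomorphic_on ball 0 1" "hardy_le p f 1" "\<forall>z. norm z \<le> \<rho> \<longrightarrow> norm (f z) \<le> \<delta>"
    \<comment> \<open>Elements of the Hardy space vanish outside the disc.\<close>
    define f0 where "f0 = (\<lambda>z. if norm z < 1 then f z else 0)"
    have hol0: "f0 holomorphic_on ball 0 1"
      using f(1) by (rule holomorphic_transform) (simp add: f0_def)
    have le0: "hardy_le p f0 1"
      using f(2) hardy_le_cong[of f0 f p 1] by (simp add: f0_def)
    have H0: "f0 \<in> hardy_space p"
      using hol0 le0 unfolding hardy_space_iff[OF p] by (auto simp: f0_def intro!: exI[of _ 1])
    have "f0 \<in> ?B" using H0 le0 hardy_norm_le_iff[OF p H0, of 1] by simp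
    then obtain U where U: "U \<in> F" "?T f0 \<in> U" using S(2) F(3) by blast
    have notV: "?T f0 \<notin> V (z, c)" if zc: "(z, c) \<in> A" for z c
    proof -
      have z: "norm z < 1" using zc A(2) by (auto simp: I_def)
      have b: "norm (\<phi> z) \<le> \<rho>" "norm (\<psi> z) \<le> \<rho>" "2 * \<delta> \<le> c" using \<rho>(3)[OF zc] by auto
      then have "norm (f (\<phi> z) - f (\<psi> z)) \<le> \<delta> + \<delta>"
        using f(3) by (intro order_trans[OF norm_triangle_ineq4] add_mono) auto
      moreover have "?T f0 z = f (\<phi> z) - f (\<psi> z)"
        using z b \<rho>(1) by (simp add: composition_operator_def f0_def)
      ultimately show ?thesis using b(3) unfolding V_def by simp
    qed
    have "U = V0"
    proof (rule ccontr)
      assume "U \<noteq> V0"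
      then have "U \<in> V ` A" using U(1) A(3) by blast
      then obtain z c where "(z, c) \<in> A" "U = V (z, c)" by auto
      then show False using notV U(2) by blast
    qed
    then have "?T f0 \<in> V0" using U(2) by blast
    then have "hardy_le p (\<lambda>z. f0 (\<phi> z) - f0 (\<psi> z)) \<epsilon>"
      using V0_le hardy_le_composition_difference by blast
    then show "hardy_le p (\<lambda>z. f (\<phi> z) - f (\<psi> z)) \<epsilon>"
      using hardy_le_cong[of "\<lambda>z. f0 (\<phi> z) - f0 (\<psi> z)" "\<lambda>z. f (\<phi> z) - f (\<psi> z)" p \<epsilon>]
        self_map_less[OF \<phi>] self_map_less[OF \<psi>] by (simp add: f0_def)
  qed (use \<rho> in auto)
qed

text \<open>The point estimate bounds the ball uniformly on compact subsets, so Montel's theorem applies; the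
circle means pass to the limit.\<close>

lemma hardy_ball_montel:
  assumes p: "0 < p" and F: "\<And>n. F n holomorphic_on ball 0 1" "\<And>n. hardy_le p (F n) 1"
  obtains f r where "f holomorphic_on ball 0 1" "hardy_le p f 1" "strict_mono (r :: nat \<Rightarrow> nat)"
    "\<And>K. compact K \<Longrightarrow> K \<subseteq> ball 0 1 \<Longrightarrow> uniform_limit K (F \<circ> r) f sequentially"
proof -
  define \<H> where "\<H> = {f. f holomorphic_on ball 0 1 \<and> hardy_le p f 1}"
  have bound: "\<exists>B. \<forall>h\<in>\<H>. \<forall>z\<in>K. norm (h z) \<le> B" if K: "compact K" "K \<subseteq> ball 0 1" for K
  proof (cases "K = {}")
    case False
    obtain z0 where z0: "z0 \<in> K" "\<And>z. z \<in> K \<Longrightarrow> norm z \<le> norm z0"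
      using continuous_attains_sup[OF K(1) False, of norm] by (auto intro: continuous_intros)
    have z01: "norm z0 < 1" using z0 K by auto
    have "norm (h z) \<le> (2 / (1 - norm z0)) powr (1 / p)" if h: "h \<in> \<H>" and z: "z \<in> K" for h z
    proof -
      have "norm z < 1" using z K by auto
      then have "norm (h z) powr p \<le> 2 / (1 - norm z) * 1"
        using h p by (intro hardy_point_estimate) (auto simp: \<H>_def)
      also have "\<dots> \<le> 2 / (1 - norm z0)" using z0(2)[OF z] z01 by (simp add: frac_le)
      finally have "(norm (h z) powr p) powr (1 / p) \<le> (2 / (1 - norm z0)) powr (1 / p)"
        using p by (intro powr_mono2) auto
      then show ?thesis using p by (simp add: powr_powr)
    qed
    then show ?thesis by blast
  qed auto
  obtain f r where f: "f holomorphic_on ball 0 1" and r: "strict_mono (r :: nat \<Rightarrow> nat)"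
    and pt: "\<And>x. x \<in> ball 0 1 \<Longrightarrow> (\<lambda>n. F (r n) x) \<longlonglongrightarrow> f x"
    and unif: "\<And>K. compact K \<Longrightarrow> K \<subseteq> ball 0 1 \<Longrightarrow> uniform_limit K (F \<circ> r) f sequentially"
    by (rule Montel[of "ball 0 1" \<H> F, OF open_ball _ bound]) (use F in \<open>auto simp: \<H>_def\<close>)
  have "hardy_le p f 1"
    unfolding hardy_le_def
  proof (intro allI impI)
    fix s :: real assume s: "0 < s" "s < 1"
    have in_disc: "of_real s * \<zeta> \<in> ball 0 1" if "norm \<zeta> = 1" for \<zeta> :: complex
      using norm_scale_less[OF s, of \<zeta>] that by simp
    have "cball 0 s \<subseteq> ball (0::complex) 1" using s by auto
    from bound[OF compact_cball this]
    obtain B where B: "\<And>h z. h \<in> \<H> \<Longrightarrow> z \<in> cball 0 s \<Longrightarrow> norm (h z) \<le> B" by blast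
    have "(\<lambda>n. hardy_mean p (F (r n)) s) \<longlonglongrightarrow> hardy_mean p f s"
      unfolding hardy_mean_def
    proof (rule circle_integral_tendsto[where B="B powr p"])
      fix n and \<zeta> :: complex assume "norm \<zeta> = 1"
      then show "norm (norm (F (r n) (of_real s * \<zeta>)) powr p) \<le> B powr p"
        using B[of "F (r n)" "of_real s * \<zeta>"] F s p by (auto simp: \<H>_def norm_mult intro!: powr_mono2)
    next
      fix \<zeta> :: complex assume "norm \<zeta> = 1"
      then show "(\<lambda>n. norm (F (r n) (of_real s * \<zeta>)) powr p) \<longlonglongrightarrow> norm (f (of_real s * \<zeta>)) powr p"
        by (intro powr_norm_tendsto pt in_disc p)
    qed (rule continuous_on_dilate_powr[OF F(1) s p] continuous_on_dilate_powr[OF f s p])+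
    then show "hardy_mean p f s \<le> 1"
      using F(2) s unfolding hardy_le_def by (intro LIMSEQ_le_const2) auto
  qed
  with f r unif show ?thesis by (intro that)
qed

text \<open>A sequence in the ball has a subsequence that converges locally uniformly to some \<open>f\<close> in the ball.
The differences to \<open>f\<close> are bounded and tend to 0 locally uniformly, so their images tend to 0 in
quasi-norm. Thus the image of the ball is itself compact.\<close>

lemma null_to_null_imp_compact:
  assumes p: "0 < p" and \<phi>: "holomorphic_self_map \<phi>" and \<psi>: "holomorphic_self_map \<psi>"
    and null: "null_to_null p \<phi> \<psi>"
  shows "compact_on_hardy p (composition_difference \<phi> \<psi>)"
proof -
  interpret Metric_space "hardy_space p" "hardy_dist p" by (rule Metric_space_hardy[OF p])
  let ?T = "composition_difference \<phi> \<psi>"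
  let ?B = "{f \<in> hardy_space p. hardy_norm p f \<le> 1}"
  have TH: "?T f \<in> hardy_space p" if "f \<in> hardy_space p" for f
    by (rule composition_difference_hardy_space[OF p \<phi> \<psi> that])
  have ball_iff: "f \<in> ?B \<longleftrightarrow> f \<in> hardy_space p \<and> hardy_le p f 1" for f
    using hardy_norm_le_iff[OF p, of f 1] by auto
  have "compactin mtopology (?T ` ?B)"
    unfolding compactin_sequentially
  proof (intro conjI allI impI)
    show "?T ` ?B \<subseteq> hardy_space p" using TH by blast
    fix \<sigma> :: "nat \<Rightarrow> complex \<Rightarrow> complex" assume \<sigma>: "range \<sigma> \<subseteq> ?T ` ?B"
    have "\<forall>n. \<exists>f. f \<in> ?B \<and> \<sigma> n = ?T f" using \<sigma> by blast
    then obtain F where "\<And>n. F n \<in> ?B \<and> \<sigma> n = ?T (F n)" by metis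
    then have FH: "\<And>n. F n \<in> hardy_space p" and F1: "\<And>n. hardy_le p (F n) 1" and F\<sigma>: "\<And>n. \<sigma> n = ?T (F n)"
      using ball_iff by auto
    have Fhol: "F n holomorphic_on ball 0 1" for n using FH[of n] by (simp add: hardy_space_def)
    obtain g r where g: "g holomorphic_on ball 0 1" "hardy_le p g 1" and r: "strict_mono (r :: nat \<Rightarrow> nat)"
      and unif: "\<And>K. compact K \<Longrightarrow> K \<subseteq> ball 0 1 \<Longrightarrow> uniform_limit K (F \<circ> r) g sequentially"
      by (rule hardy_ball_montel[OF p, of F, OF Fhol F1]) (rule that; blast)
    define f where "f = (\<lambda>z. if norm z < 1 then g z else 0)"
    have fhol: "f holomorphic_on ball 0 1"
      using g(1) by (rule holomorphic_transform) (simp add: f_def)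
    have f1: "hardy_le p f 1"
      using g(2) hardy_le_cong[of f g p 1] by (simp add: f_def)
    have fH: "f \<in> hardy_space p"
      using fhol f1 unfolding hardy_space_iff[OF p] by (auto simp: f_def intro!: exI[of _ 1])
    have "limitin mtopology (\<sigma> \<circ> r) (?T f) sequentially"
      unfolding limit_metric_sequentially
    proof (intro conjI allI impI TH fH)
      fix \<epsilon> :: real assume \<epsilon>: "0 < \<epsilon>"
      \<comment> \<open>The metric is the power \<alpha> of the quasi-norm, so a quasi-norm of at most e gives a distance of at most \<epsilon> / 2.\<close>
      define \<alpha> where "\<alpha> = min 1 p"
      define e where "e = (\<epsilon> / 2) powr (1 / \<alpha>)"
      have \<alpha>: "0 < \<alpha>" using p by (simp add: \<alpha>_def)
      have e: "0 < e" "e powr \<alpha> = \<epsilon> / 2" using \<epsilon> \<alpha> by (auto simp: e_def powr_powr)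
      have ep: "0 < e powr p" using e by simp
      obtain \<rho> \<delta> where \<rho>: "\<rho> < 1" and \<delta>: "0 < \<delta>" and nl:
        "\<And>h. h holomorphic_on ball 0 1 \<Longrightarrow> hardy_le p h (2 powr p * 1 + 2 powr p * 1) \<Longrightarrow>
           (\<And>z. norm z \<le> \<rho> \<Longrightarrow> norm (h z) \<le> \<delta>) \<Longrightarrow> hardy_le p (\<lambda>z. h (\<phi> z) - h (\<psi> z)) (e powr p)"
        by (rule null_to_nullD[OF null p ep, of "2 powr p * 1 + 2 powr p * 1"], rule that, assumption, assumption, blast)
      have "uniform_limit (cball 0 \<rho>) (F \<circ> r) g sequentially"
        using \<rho> by (intro unif) auto
      then obtain n0 where n0: "\<And>n z. n0 \<le> n \<Longrightarrow> norm z \<le> \<rho> \<Longrightarrow> dist (F (r n) z) (g z) < \<delta>"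
        using \<delta> unfolding uniform_limit_sequentially_iff by fastforce
      show "\<exists>n0. \<forall>n\<ge>n0. (\<sigma> \<circ> r) n \<in> hardy_space p \<and> hardy_dist p ((\<sigma> \<circ> r) n) (?T f) < \<epsilon>"
      proof (intro exI[of _ n0] allI impI conjI)
        fix n assume n: "n0 \<le> n"
        show "(\<sigma> \<circ> r) n \<in> hardy_space p" using TH[OF FH] by (simp add: F\<sigma>)
        have "hardy_le p (\<lambda>z. (F (r n) (\<phi> z) - f (\<phi> z)) - (F (r n) (\<psi> z) - f (\<psi> z))) (e powr p)"
        proof (rule nl)
          show "(\<lambda>z. F (r n) z - f z) holomorphic_on ball 0 1"
            by (intro holomorphic_intros Fhol fhol)
          show "hardy_le p (\<lambda>z. F (r n) z - f z) (2 powr p * 1 + 2 powr p * 1)"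
            by (intro hardy_le_diff Fhol fhol p F1 f1)
          show "norm (F (r n) z - f z) \<le> \<delta>" if "norm z \<le> \<rho>" for z
            using n0[OF n that] that \<rho> by (simp add: f_def dist_norm)
        qed
        moreover have "?T (F (r n)) - ?T f = ?T (F (r n) - f)"
          by (auto simp: fun_eq_iff composition_operator_def)
        ultimately have le: "hardy_le p (?T (F (r n)) - ?T f) (e powr p)"
          using hardy_le_composition_difference[where f="F (r n) - f" and \<phi>=\<phi> and \<psi>=\<psi>] by simp
        have "hardy_norm p (?T (F (r n)) - ?T f) \<le> e"
          using hardy_norm_le_iff[OF p hardy_space_diff[OF p TH[OF FH] TH[OF fH]], of e] le e by simp
        then have "hardy_dist p (?T (F (r n))) (?T f) \<le> e powr \<alpha>"
          unfolding hardy_dist_def \<alpha>_def[symmetric] using \<alpha> by (intro powr_mono2) auto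
        then show "hardy_dist p ((\<sigma> \<circ> r) n) (?T f) < \<epsilon>"
          using e \<epsilon> by (simp add: F\<sigma>)
      qed
    qed
    moreover have "?T f \<in> ?T ` ?B" using ball_iff fH f1 by blast
    ultimately show "\<exists>l r. l \<in> ?T ` ?B \<and> strict_mono r \<and> limitin mtopology (\<sigma> \<circ> r) l sequentially"
      using r by blast
  qed
  moreover from this have "mtopology closure_of (?T ` ?B) = ?T ` ?B"
    by (intro closure_of_closedin compactin_imp_closedin Hausdorff_space_mtopology)
  ultimately show ?thesis
    unfolding compact_operator_def relatively_compactin_def quasinorm_topology_hardy[OF p]
    using TH by auto
qed

theorem corollary1p2:
  fixes \<phi> \<psi> :: "complex \<Rightarrow> complex" and p q :: real
  assumes "holomorphic_self_map \<phi>" and "holomorphic_self_map \<psi>"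
    and "0 < p" and "0 < q"
  shows "compact_on_hardy p (\<lambda>f. composition_operator \<phi> f - composition_operator \<psi> f) \<longleftrightarrow>
         compact_on_hardy q (\<lambda>f. composition_operator \<phi> f - composition_operator \<psi> f)"
proof -
  have "compact_on_hardy s (composition_difference \<phi> \<psi>) \<longleftrightarrow> null_to_null s \<phi> \<psi>" if "0 < s" for s
    using compact_imp_null_to_null null_to_null_imp_compact assms that by blast
  then show ?thesis
    using null_to_null_transfer assms by blast
qed

end
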